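(* Let $\frac13<\beta<H<\frac12$, $A\in\mathbb{R}^{m\times m}$, let $f:\mathbb{R}^m\to\mathbb{R}^m$ be globally Lipschitz continuous, and let $g\in C_b^3(\mathbb{R}^m,\mathbb{R}^{m\times d})$. Let $\varphi:\mathbb{R}^+\times\Omega'\times\mathbb{R}^m\to\mathbb{R}^m$, $\varphi(t,\omega,\xi)=y_t$, be the random dynamical system over $(\Omega',\mathcal{F}',\mathbb{P}'_H,\theta')$ generated by the rough differential equation $dy=(Ay+f(y))\,dt+g(y)\,d\boldsymbol{\omega}$, $y_0=\xi$. Then, likewise, the solution $y^\delta_t\in\mathbb{R}^m$ of the approximating equation $dy^\delta=(Ay^\delta+f(y^\delta))\,dt+g(y^\delta)\,d\boldsymbol{\omega}_\delta$ generates a random dynamical system $\varphi^\delta$. In addition, the Wong-Zakai approximation of the solutions (the convergence of $y^\delta$ to $y$ recalled at the end of the context) implies that $\varphi^\delta\to\varphi$ as $\delta\to0$.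
   Context: Noise: $\omega^1$ is the canonical two-sided fractional Brownian motion in $\mathbb{R}^d$ with Hurst index $H$ and independent components, i.e. the coordinate process on $(\Omega,\mathcal{F},\mathbb{P}_H)$, where $\Omega\subset C_0(\mathbb{R},\mathbb{R}^d)$ is a $\theta$-invariant full-measure set of paths that are $\beta$-Hölder continuous $(\beta<H)$ on every $[-T,T]$, $\mathcal{F}$ is the trace on $\Omega$ of the Borel $\sigma$-algebra of $C_0(\mathbb{R},\mathbb{R}^d)$ (continuous functions vanishing at zero, compact-open topology), $\mathbb{P}_H$ is the law of the fractional Brownian motion, and $\theta_t\omega(\cdot)=\omega(\cdot+t)-\omega(t)$. For $\delta\in(0,1)$ put $W_\delta(t,\omega^1)=\int_0^t\frac1\delta(\omega^1(r+\delta)-\omega^1(r))\,dr$, $\mathbb{W}_\delta(\omega^1)_{s,t}=\int_s^tW_\delta(\cdot,\omega^1)_{s,r}\otimes dW_\delta(r,\omega^1)$ and $\boldsymbol{\omega}_\delta=(W_\delta(\cdot,\omega^1),\mathbb{W}_\delta(\omega^1))$. $\Omega'\subset\Omega$ is a $\theta$-invariant set of full measure such that, for each $\omega\in\Omega'$, $\boldsymbol{\omega}_\delta$ converges as $\delta\to0$, on every $[-T,T]$, to the fractional Brownian rough path $\boldsymbol{\omega}=(\omega^1,\omega^2)$ in the metric $\rho_\beta(\mathbf{X},\mathbf{Y})=\sup_{s\ne t}\frac{|X_{s,t}-Y_{s,t}|}{|t-s|^\beta}+\sup_{s\ne t}\frac{|\mathbb{X}_{s,t}-\mathbb{Y}_{s,t}|}{|t-s|^{2\beta}}$.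 $\mathcal{F}'=\mathcal{F}\cap\Omega'$, and $\mathbb{P}'_H$, $\theta'$ are the restrictions of $\mathbb{P}_H$, $\theta$; $(\Omega',\mathcal{F}',\mathbb{P}'_H,\theta')$ is an ergodic metric dynamical system. Random dynamical system over $(\Omega',\mathcal{F}',\mathbb{P}'_H,\theta')$: a map $\varphi:\mathbb{R}^+\times\Omega'\times\mathbb{R}^m\to\mathbb{R}^m$ that is $(\mathcal{B}(\mathbb{R}^+)\otimes\mathcal{F}'\otimes\mathcal{B}(\mathbb{R}^m),\mathcal{B}(\mathbb{R}^m))$-measurable, with $\varphi(0,\omega,\cdot)=\mathrm{Id}$ and $\varphi(t_1+t_2,\omega,\cdot)=\varphi(t_2,\theta'_{t_1}\omega,\varphi(t_1,\omega,\cdot))$ for all $t_1,t_2\in\mathbb{R}^+$, $\omega\in\Omega'$. Solutions: write $y_{s,t}=y_t-y_s$. A solution of $dy=(Ay+f(y))dt+g(y)d\boldsymbol{X}$ driven by a $\beta$-Hölder rough path $\boldsymbol{X}=(X,\mathbb{X})$ is a $\beta$-Hölder path $y$ such that the remainder $R^y_{s,t}:=y_{s,t}-g(y_s)X_{s,t}$ is $2\beta$-Hölder and $y_{s,t}=\int_s^t(Ay_r+f(y_r))dr+\int_s^tg(y_r)d\boldsymbol{X}_r$, where $\int_s^tg(y_r)d\boldsymbol{X}_r=\lim_{|\mathcal{P}|\to0}\sum_{[u,v]\in\mathcal{P}}\left(g(y_u)X_{u,v}+Dg(y_u)g(y_u)\mathbb{X}_{u,v}\right)$ over partitions $\mathcal{P}$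 of $[s,t]$. Under the stated assumptions solutions exist and are unique for every initial value on every finite interval. $g\in C_b^3$ means three times continuously differentiable with $g,Dg,D^2g,D^3g$ bounded. Wong-Zakai approximation of the solutions: with $p=\frac1\beta$, $q=\frac p2$, for any $\tau\in\mathbb{R}$ and $T>0$, if $\|y^\delta_\tau-y_\tau\|\to0$ as $\delta\to0$, then $\|y-y^\delta\|_{\infty,[\tau,\tau+T]}+|||y-y^\delta|||_{p\text{-var},[\tau,\tau+T]}+|||R^{y^\delta}-R^y|||_{q\text{-var},[\tau,\tau+T]^2}\to0$ as $\delta\to0$. Here $\|\cdot\|_{\infty,I}$ is the supremum norm on $I$, $|||y|||_{p\text{-var},I}=\big(\sup_{\mathcal{P}(I)}\sum_{[u,v]\in\mathcal{P}(I)}\|y_{u,v}\|^p\big)^{1/p}$ and $|||R|||_{q\text{-var},I^2}=\big(\sup_{\mathcal{P}(I)}\sum_{[u,v]\in\mathcal{P}(I)}\|R_{u,v}\|^q\big)^{1/q}$, the suprema being over partitions of $I$. *)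

theory Defs
  imports "HOL-Probability.Probability"
begin

section \<open>Canonical two-sided fractional Brownian motion\<close>

definition C0 :: "(real \<Rightarrow> real ^ 'd) set" where
  "C0 = {\<omega>. continuous_on UNIV \<omega> \<and> \<omega> 0 = 0}"

definition compact_open_C0 :: "(real \<Rightarrow> real ^ 'd) topology" where
  "compact_open_C0 =
     topology_generated_by {{\<omega> \<in> C0. \<omega> ` K \<subseteq> U} | K U. compact K \<and> open U}"

definition borel_C0 :: "(real \<Rightarrow> real ^ 'd) measure" where
  "borel_C0 = sigma C0 {U. openin compact_open_C0 U}"

definition wiener_shift :: "real \<Rightarrow> (real \<Rightarrow> real ^ 'd) \<Rightarrow> real \<Rightarrow> real ^ 'd" where
  "wiener_shift t \<omega> = (\<lambda>r. \<omega> (r + t) - \<omega> t)"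

text \<open>The first alternative is the degenerate Gaussian law of variance zero, which
  occurs for instance at time zero; it has no density.\<close>

definition centered_gaussian :: "'a measure \<Rightarrow> ('a \<Rightarrow> real) \<Rightarrow> bool" where
  "centered_gaussian M X \<longleftrightarrow>
     X \<in> borel_measurable M \<and>
     (distr M borel X = return borel 0 \<or>
      (\<exists>\<sigma>>0. distributed M lborel X (normal_density 0 \<sigma>)))"

definition centered_gaussian_process :: "'a measure \<Rightarrow> (real \<Rightarrow> 'a \<Rightarrow> real) \<Rightarrow> bool" where
  "centered_gaussian_process M X \<longleftrightarrow>
     (\<forall>J c. finite J \<longrightarrow> centered_gaussian M (\<lambda>\<omega>. \<Sum>t\<in>J. c t * X t \<omega>))"

definition fractional_brownian_motion :: "real \<Rightarrow> 'a measure \<Rightarrow> (real \<Rightarrow> 'a \<Rightarrow> real) \<Rightarrow> bool" where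
  "fractional_brownian_motion H M X \<longleftrightarrow>
     centered_gaussian_process M X \<and>
     (\<forall>s t. integral\<^sup>L M (\<lambda>\<omega>. X s \<omega> * X t \<omega>) =
        (\<bar>s\<bar> powr (2 * H) + \<bar>t\<bar> powr (2 * H) - \<bar>t - s\<bar> powr (2 * H)) / 2)"

definition fbm_law :: "real \<Rightarrow> (real \<Rightarrow> real ^ 'd) measure \<Rightarrow> bool" where
  "fbm_law H P \<longleftrightarrow>
     prob_space P \<and> space P = C0 \<and> sets P = sets borel_C0 \<and>
     (\<forall>i. fractional_brownian_motion H P (\<lambda>t \<omega>. \<omega> t $ i)) \<and>
     prob_space.indep_vars P (\<lambda>i. PiM (UNIV :: real set) (\<lambda>_. borel))
       (\<lambda>i \<omega> t. \<omega> t $ i) (UNIV :: 'd set)"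

section \<open>Random dynamical systems\<close>

definition metric_dynamical_system :: "'a measure \<Rightarrow> (real \<Rightarrow> 'a \<Rightarrow> 'a) \<Rightarrow> bool" where
  "metric_dynamical_system M \<theta> \<longleftrightarrow>
     prob_space M \<and>
     (\<lambda>(t, \<omega>). \<theta> t \<omega>) \<in> borel \<Otimes>\<^sub>M M \<rightarrow>\<^sub>M M \<and>
     (\<forall>\<omega>\<in>space M. \<theta> 0 \<omega> = \<omega>) \<and>
     (\<forall>s t. \<forall>\<omega>\<in>space M. \<theta> (s + t) \<omega> = \<theta> s (\<theta> t \<omega>)) \<and>
     (\<forall>t. distr M M (\<theta> t) = M)"

definition ergodic_metric_dynamical_system :: "'a measure \<Rightarrow> (real \<Rightarrow> 'a \<Rightarrow> 'a) \<Rightarrow> bool" where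
  "ergodic_metric_dynamical_system M \<theta> \<longleftrightarrow>
     metric_dynamical_system M \<theta> \<and>
     (\<forall>A\<in>sets M. (\<forall>t. \<theta> t -` A \<inter> space M = A) \<longrightarrow> measure M A = 0 \<or> measure M A = 1)"

definition random_dynamical_system ::
  "'a measure \<Rightarrow> (real \<Rightarrow> 'a \<Rightarrow> 'a) \<Rightarrow> (real \<Rightarrow> 'a \<Rightarrow> 'b::topological_space \<Rightarrow> 'b) \<Rightarrow> bool" where
  "random_dynamical_system M \<theta> \<phi> \<longleftrightarrow>
     (\<lambda>(t, \<omega>, x). \<phi> t \<omega> x) \<in> restrict_space borel {0..} \<Otimes>\<^sub>M (M \<Otimes>\<^sub>M borel) \<rightarrow>\<^sub>M borel \<and>
     (\<forall>\<omega>\<in>space M. \<forall>x. \<phi> 0 \<omega> x = x) \<and>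
     (\<forall>s\<ge>0. \<forall>t\<ge>0. \<forall>\<omega>\<in>space M. \<forall>x. \<phi> (s + t) \<omega> x = \<phi> t (\<theta> s \<omega>) (\<phi> s \<omega> x))"

section \<open>Rough paths\<close>

definition incr :: "(real \<Rightarrow> 'a::real_normed_vector) \<Rightarrow> real \<Rightarrow> real \<Rightarrow> 'a" where
  "incr y s t = y t - y s"

definition tensor :: "real ^ 'd \<Rightarrow> real ^ 'd \<Rightarrow> real ^ 'd ^ 'd" where
  "tensor a b = (\<chi> i j. a $ i * b $ j)"

definition holder :: "real \<Rightarrow> real set \<Rightarrow> (real \<Rightarrow> real \<Rightarrow> 'a::real_normed_vector) \<Rightarrow> bool" where
  "holder \<gamma> S F \<longleftrightarrow> (\<exists>C. \<forall>s\<in>S. \<forall>t\<in>S. norm (F s t) \<le> C * \<bar>t - s\<bar> powr \<gamma>)"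

definition rough_path ::
  "real \<Rightarrow> real set \<Rightarrow> (real \<Rightarrow> real ^ 'd) \<Rightarrow> (real \<Rightarrow> real \<Rightarrow> real ^ 'd ^ 'd) \<Rightarrow> bool" where
  "rough_path \<beta> S X XX \<longleftrightarrow>
     holder \<beta> S (incr X) \<and> holder (2 * \<beta>) S XX \<and>
     (\<forall>s\<in>S. \<forall>u\<in>S. \<forall>t\<in>S. XX s t = XX s u + XX u t + tensor (incr X s u) (incr X u t))"

text \<open>The supremum is real-valued, so it is meaningful only for \<open>\<gamma>\<close>-Hoelder \<open>F\<close>; this
  is the case in every use below.\<close>

definition holder_seminorm ::
  "real \<Rightarrow> real set \<Rightarrow> (real \<Rightarrow> real \<Rightarrow> 'a::real_normed_vector) \<Rightarrow> real" where
  "holder_seminorm \<gamma> S F =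
     (SUP (s, t)\<in>{(s, t). s \<in> S \<and> t \<in> S \<and> s \<noteq> t}. norm (F s t) / \<bar>t - s\<bar> powr \<gamma>)"

definition rough_dist ::
  "real \<Rightarrow> real set \<Rightarrow> (real \<Rightarrow> real ^ 'd) \<Rightarrow> (real \<Rightarrow> real \<Rightarrow> real ^ 'd ^ 'd) \<Rightarrow>
     (real \<Rightarrow> real ^ 'd) \<Rightarrow> (real \<Rightarrow> real \<Rightarrow> real ^ 'd ^ 'd) \<Rightarrow> real" where
  "rough_dist \<beta> S X XX Y YY =
     holder_seminorm \<beta> S (\<lambda>s t. incr X s t - incr Y s t) +
     holder_seminorm (2 * \<beta>) S (\<lambda>s t. XX s t - YY s t)"

text \<open>\<open>LBINT r=s..t\<close> is the oriented integral, so the definitions cover negative times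
  and \<open>t < s\<close>.  As \<open>W\<delta>\<close> is continuously differentiable, the integral against
  \<open>dW\<delta>(r)\<close> is the integral against its derivative times \<open>dr\<close>.\<close>

definition W\<delta> :: "real \<Rightarrow> (real \<Rightarrow> real ^ 'd) \<Rightarrow> real \<Rightarrow> real ^ 'd" where
  "W\<delta> \<delta> \<omega> t = (LBINT r=ereal 0..ereal t. (1 / \<delta>) *\<^sub>R (\<omega> (r + \<delta>) - \<omega> r))"

definition WW\<delta> :: "real \<Rightarrow> (real \<Rightarrow> real ^ 'd) \<Rightarrow> real \<Rightarrow> real \<Rightarrow> real ^ 'd ^ 'd" where
  "WW\<delta> \<delta> \<omega> s t =
     (LBINT r=ereal s..ereal t.
        tensor (incr (W\<delta> \<delta> \<omega>) s r) (vector_derivative (W\<delta> \<delta> \<omega>) (at r)))"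

section \<open>Rough differential equations\<close>

definition Cb3 :: "('a::real_normed_vector \<Rightarrow> 'b::real_normed_vector) \<Rightarrow> bool" where
  "Cb3 g \<longleftrightarrow>
     (\<exists>(D1 :: 'a \<Rightarrow> 'a \<Rightarrow>\<^sub>L 'b) (D2 :: 'a \<Rightarrow> 'a \<Rightarrow>\<^sub>L 'a \<Rightarrow>\<^sub>L 'b)
        (D3 :: 'a \<Rightarrow> 'a \<Rightarrow>\<^sub>L 'a \<Rightarrow>\<^sub>L 'a \<Rightarrow>\<^sub>L 'b).
        (\<forall>x. (g has_derivative blinfun_apply (D1 x)) (at x)) \<and>
        (\<forall>x. (D1 has_derivative blinfun_apply (D2 x)) (at x)) \<and>
        (\<forall>x. (D2 has_derivative blinfun_apply (D3 x)) (at x)) \<and>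
        continuous_on UNIV D3 \<and>
        bounded (range g) \<and> bounded (range D1) \<and> bounded (range D2) \<and> bounded (range D3))"

text \<open>\<open>Dgg g y XX\<close> is \<open>Dg(y) g(y) XX\<close>: the linear map on matrices that sends the tensor
  of \<open>a\<close> and \<open>b\<close> to \<open>(Dg(y)(g(y) a)) b\<close>, written out in the standard basis.\<close>

definition Dgg ::
  "(real ^ 'm \<Rightarrow> real ^ 'd ^ 'm) \<Rightarrow> real ^ 'm \<Rightarrow> real ^ 'd ^ 'd \<Rightarrow> real ^ 'm" where
  "Dgg g y XX =
     (\<Sum>k\<in>UNIV. \<Sum>j\<in>UNIV. (XX $ k $ j) *\<^sub>R
        (frechet_derivative g (at y) (g y *v axis k 1) *v axis j 1))"

text \<open>A partition is a \<open>division_of\<close>; the possible one-point members contribute zero, as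
  \<open>XX u u = 0\<close> by Chen's relation.\<close>

definition has_rough_integral ::
  "(real ^ 'm \<Rightarrow> real ^ 'd ^ 'm) \<Rightarrow> (real \<Rightarrow> real ^ 'd) \<Rightarrow> (real \<Rightarrow> real \<Rightarrow> real ^ 'd ^ 'd) \<Rightarrow>
     (real \<Rightarrow> real ^ 'm) \<Rightarrow> real \<Rightarrow> real \<Rightarrow> real ^ 'm \<Rightarrow> bool" where
  "has_rough_integral g X XX y s t I \<longleftrightarrow>
     (\<forall>\<epsilon>>0. \<exists>\<eta>>0. \<forall>P. P division_of {s..t} \<and> (\<forall>K\<in>P. Sup K - Inf K < \<eta>) \<longrightarrow>
        norm ((\<Sum>K\<in>P. g (y (Inf K)) *v incr X (Inf K) (Sup K) +
                       Dgg g (y (Inf K)) (XX (Inf K) (Sup K))) - I) < \<epsilon>)"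

definition remainder ::
  "(real ^ 'm \<Rightarrow> real ^ 'd ^ 'm) \<Rightarrow> (real \<Rightarrow> real ^ 'd) \<Rightarrow> (real \<Rightarrow> real ^ 'm) \<Rightarrow>
     real \<Rightarrow> real \<Rightarrow> real ^ 'm" where
  "remainder g X y s t = incr y s t - g (y s) *v incr X s t"

definition rde_solution ::
  "real \<Rightarrow> real ^ 'm ^ 'm \<Rightarrow> (real ^ 'm \<Rightarrow> real ^ 'm) \<Rightarrow> (real ^ 'm \<Rightarrow> real ^ 'd ^ 'm) \<Rightarrow>
     (real \<Rightarrow> real ^ 'd) \<Rightarrow> (real \<Rightarrow> real \<Rightarrow> real ^ 'd ^ 'd) \<Rightarrow>
     real \<Rightarrow> real \<Rightarrow> (real \<Rightarrow> real ^ 'm) \<Rightarrow> bool" where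
  "rde_solution \<beta> A f g X XX a b y \<longleftrightarrow>
     holder \<beta> {a..b} (incr y) \<and>
     holder (2 * \<beta>) {a..b} (remainder g X y) \<and>
     (\<forall>s t. a \<le> s \<and> s \<le> t \<and> t \<le> b \<longrightarrow>
        has_rough_integral g X XX y s t
          (incr y s t - integral {s..t} (\<lambda>r. A *v y r + f (y r))))"

text \<open>The driving rough path is \<open>(X \<omega>, XX \<omega>)\<close>.\<close>

definition generated_by_rde ::
  "real \<Rightarrow> real ^ 'm ^ 'm \<Rightarrow> (real ^ 'm \<Rightarrow> real ^ 'm) \<Rightarrow> (real ^ 'm \<Rightarrow> real ^ 'd ^ 'm) \<Rightarrow>
     'a set \<Rightarrow> ('a \<Rightarrow> real \<Rightarrow> real ^ 'd) \<Rightarrow> ('a \<Rightarrow> real \<Rightarrow> real \<Rightarrow> real ^ 'd ^ 'd) \<Rightarrow>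
     (real \<Rightarrow> 'a \<Rightarrow> real ^ 'm \<Rightarrow> real ^ 'm) \<Rightarrow> bool" where
  "generated_by_rde \<beta> A f g \<Omega> X XX \<phi> \<longleftrightarrow>
     (\<forall>\<omega>\<in>\<Omega>. \<forall>\<xi>. \<phi> 0 \<omega> \<xi> = \<xi> \<and>
        (\<forall>T>0. rde_solution \<beta> A f g (X \<omega>) (XX \<omega>) 0 T (\<lambda>t. \<phi> t \<omega> \<xi>) \<and>
           (\<forall>y. rde_solution \<beta> A f g (X \<omega>) (XX \<omega>) 0 T y \<and> y 0 = \<xi> \<longrightarrow>
              (\<forall>t\<in>{0..T}. y t = \<phi> t \<omega> \<xi>))))"

section \<open>The Wong-Zakai approximation\<close>

definition pvar ::
  "real \<Rightarrow> real \<Rightarrow> real \<Rightarrow> (real \<Rightarrow> real \<Rightarrow> 'a::real_normed_vector) \<Rightarrow> real" where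
  "pvar p a b F =
     (SUP P\<in>{P. P division_of {a..b}}. \<Sum>K\<in>P. norm (F (Inf K) (Sup K)) powr p) powr (1 / p)"

text \<open>The suprema are finite: for \<open>p = 1/\<beta>\<close> a \<open>\<beta>\<close>-Hoelder path has finite
  \<open>p\<close>-variation and a \<open>2\<beta>\<close>-Hoelder remainder has finite \<open>p/2\<close>-variation.\<close>

definition wong_zakai_approximation ::
  "real \<Rightarrow> real ^ 'm ^ 'm \<Rightarrow> (real ^ 'm \<Rightarrow> real ^ 'm) \<Rightarrow> (real ^ 'm \<Rightarrow> real ^ 'd ^ 'm) \<Rightarrow>
     (real \<Rightarrow> real ^ 'd) set \<Rightarrow> ((real \<Rightarrow> real ^ 'd) \<Rightarrow> real \<Rightarrow> real \<Rightarrow> real ^ 'd ^ 'd) \<Rightarrow> bool" where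
  "wong_zakai_approximation \<beta> A f g \<Omega> \<omega>2 \<longleftrightarrow>
     (\<forall>\<omega>\<in>\<Omega>. \<forall>\<tau> T y y\<delta>.
        T > 0 \<and>
        rde_solution \<beta> A f g \<omega> (\<omega>2 \<omega>) \<tau> (\<tau> + T) y \<and>
        (\<forall>\<delta>\<in>{0<..<1}. rde_solution \<beta> A f g (W\<delta> \<delta> \<omega>) (WW\<delta> \<delta> \<omega>) \<tau> (\<tau> + T) (y\<delta> \<delta>)) \<and>
        ((\<lambda>\<delta>. norm (y\<delta> \<delta> \<tau> - y \<tau>)) \<longlongrightarrow> 0) (at_right 0) \<longrightarrow>
        ((\<lambda>\<delta>. (SUP t\<in>{\<tau>..\<tau> + T}. norm (y t - y\<delta> \<delta> t)) +
              pvar (1 / \<beta>) \<tau> (\<tau> + T) (incr (\<lambda>t. y t - y\<delta> \<delta> t)) +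
              pvar (1 / \<beta> / 2) \<tau> (\<tau> + T)
                (\<lambda>s t. remainder g (W\<delta> \<delta> \<omega>) (y\<delta> \<delta>) s t - remainder g \<omega> y s t))
           \<longlongrightarrow> 0) (at_right 0))"

end

theory Submission
  imports Defs
begin

text \<open>
  For fixed \<open>\<delta>\<close> the smoothed path \<open>W\<delta> \<delta> \<omega>\<close> is continuously differentiable, with velocity
  \<open>v(t) = (\<omega> (t + \<delta>) - \<omega> t) / \<delta>\<close>, and its iterated integral over \<open>{s..t}\<close> is of order
  \<open>(t - s)\<^sup>2\<close>. In the compensated Riemann sums of any continuous \<open>y\<close> the second level therefore
  vanishes in the limit and the rough integral is the ordinary integral of \<open>g (y r) *v v r\<close>
  (\<open>has_rough_integral_smooth\<close>). Hence the solutions of the approximating rough equation are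
  exactly the integral curves of the ordinary differential equation
  \<open>y' = A y + f y + g y v\<close> (\<open>rde_solution_smooth_iff\<close>). This settles existence and uniqueness
  together.

  The right-hand side is globally Lipschitz in \<open>y\<close>, locally uniformly in time, so Picard iteration
  converges on the whole half-line. Each iterate is an integral of a jointly measurable
  integrand, which makes the limit jointly measurable in time, path and initial value
  (\<open>measurable_ode_flow\<close>). The velocity of the shifted path is the shifted velocity, and so the
  cocycle property is uniqueness of the equation restarted at time \<open>s\<close> (\<open>ode_flow_shift\<close>).

  Finally, the flows started at \<open>\<xi>\<delta> \<delta>\<close> and \<open>\<xi>\<close> are solutions whose initial values converge; the
  Wong-Zakai property, applied from time zero on, dominates their uniform distance on \<open>{0..T}\<close>
  (\<open>wong_zakai_flow_convergence\<close>).
\<close>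

section \<open>Picard iteration for a globally Lipschitz ordinary differential equation\<close>

definition lipschitz_field :: "(real \<Rightarrow> 'b::euclidean_space \<Rightarrow> 'b) \<Rightarrow> bool" where
  "lipschitz_field F \<longleftrightarrow>
     (\<forall>T u. continuous_on {0..T} u \<longrightarrow> continuous_on {0..T} (\<lambda>t. F t (u t))) \<and>
     (\<forall>T. \<exists>K>0. \<forall>t\<in>{0..T}. \<forall>x y. norm (F t x - F t y) \<le> K * norm (x - y))"

definition integral_curve ::
  "(real \<Rightarrow> 'b::euclidean_space \<Rightarrow> 'b) \<Rightarrow> real \<Rightarrow> 'b \<Rightarrow> (real \<Rightarrow> 'b) \<Rightarrow> bool" where
  "integral_curve F T x u \<longleftrightarrow>
     continuous_on {0..T} u \<and> (\<forall>t\<in>{0..T}. u t = x + integral {0..t} (\<lambda>r. F r (u r)))"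

text \<open>The iteration uses the Lebesgue integral because measurability in a parameter is inherited
  through it (by Fubini).\<close>

primrec picard :: "(real \<Rightarrow> 'b::euclidean_space \<Rightarrow> 'b) \<Rightarrow> 'b \<Rightarrow> nat \<Rightarrow> real \<Rightarrow> 'b" where
  "picard F x 0 = (\<lambda>t. x)"
| "picard F x (Suc n) = (\<lambda>t. x + (LINT r:{0..t}|lborel. F r (picard F x n r)))"

definition ode_flow :: "(real \<Rightarrow> 'b::euclidean_space \<Rightarrow> 'b) \<Rightarrow> 'b \<Rightarrow> real \<Rightarrow> 'b" where
  "ode_flow F x t = lim (\<lambda>n. picard F x n t)"

lemma lipschitz_field_continuous:
  "lipschitz_field F \<Longrightarrow> continuous_on {0..T} u \<Longrightarrow> continuous_on {0..T} (\<lambda>t. F t (u t))"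
  unfolding lipschitz_field_def by blast

lemma lipschitz_field_bound:
  assumes "lipschitz_field F"
  obtains K where "K > 0" "\<And>t x y. t \<in> {0..T} \<Longrightarrow> norm (F t x - F t y) \<le> K * norm (x - y)"
  using assms unfolding lipschitz_field_def by meson

lemma integral_curveD:
  assumes "integral_curve F T x u"
  shows "continuous_on {0..T} u"
    and "t \<in> {0..T} \<Longrightarrow> u t = x + integral {0..t} (\<lambda>r. F r (u r))"
  using assms unfolding integral_curve_def by simp_all

lemma continuous_on_integral_upto:
  fixes h :: "real \<Rightarrow> 'b::euclidean_space"
  assumes "continuous_on {0..T} h"
  shows "continuous_on {0..T} (\<lambda>t. integral {0..t} h)"
  by (intro indefinite_integral_continuous_1 integrable_continuous_real assms)

text \<open>With distances measured by the supremum of \<open>exp (- 2 K t) * norm (u t - v t)\<close>, one integration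
  step halves them, because the integral of \<open>K * exp (2 K r)\<close> up to \<open>t\<close> is at most
  \<open>exp (2 K t) / 2\<close>. The weight makes the contraction factor one half whatever \<open>T\<close> is, so
  uniqueness and convergence of the iteration follow on arbitrarily long intervals at once.\<close>

lemma integral_curve_contraction:
  fixes F :: "real \<Rightarrow> 'b::euclidean_space \<Rightarrow> 'b"
  assumes F: "lipschitz_field F"
    and K: "K > 0" "\<And>t x y. t \<in> {0..T} \<Longrightarrow> norm (F t x - F t y) \<le> K * norm (x - y)"
    and u: "continuous_on {0..T} u" and v: "continuous_on {0..T} v"
    and c: "c \<ge> 0" "\<And>t. t \<in> {0..T} \<Longrightarrow> norm (u t - v t) \<le> c * exp (2 * K * t)"
    and t: "t \<in> {0..T}"
  shows "norm (integral {0..t} (\<lambda>r. F r (u r)) - integral {0..t} (\<lambda>r. F r (v r)))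
           \<le> c / 2 * exp (2 * K * t)"
proof -
  have sub: "{0..t} \<subseteq> {0..T}" using t by auto
  have cu: "continuous_on {0..t} (\<lambda>r. F r (u r))" "continuous_on {0..t} (\<lambda>r. F r (v r))"
    using lipschitz_field_continuous[OF F] u v continuous_on_subset[OF _ sub] by blast+
  have "((\<lambda>r. K * c * exp (2 * K * r)) has_integral
          (c / 2 * exp (2 * K * t) - c / 2 * exp (2 * K * 0))) {0..t}"
    using t
    by (intro fundamental_theorem_of_calculus)
       (auto intro!: derivative_eq_intros simp flip: has_real_derivative_iff_has_vector_derivative)
  then have I: "(\<lambda>r. K * c * exp (2 * K * r)) integrable_on {0..t}"
    "integral {0..t} (\<lambda>r. K * c * exp (2 * K * r)) = c / 2 * exp (2 * K * t) - c / 2"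
    by (auto simp: has_integral_iff)
  have "norm (integral {0..t} (\<lambda>r. F r (u r)) - integral {0..t} (\<lambda>r. F r (v r)))
      = norm (integral {0..t} (\<lambda>r. F r (u r) - F r (v r)))"
    by (subst integral_diff) (auto intro!: integrable_continuous_real cu)
  also have "\<dots> \<le> integral {0..t} (\<lambda>r. K * c * exp (2 * K * r))"
  proof (rule integral_norm_bound_integral)
    show "(\<lambda>r. F r (u r) - F r (v r)) integrable_on {0..t}"
      by (intro integrable_continuous_real continuous_intros cu)
    show "norm (F r (u r) - F r (v r)) \<le> K * c * exp (2 * K * r)" if "r \<in> {0..t}" for r
    proof -
      have "norm (F r (u r) - F r (v r)) \<le> K * norm (u r - v r)" using K(2) that sub by blast
      also have "\<dots> \<le> K * (c * exp (2 * K * r))"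
        using c(2)[of r] that sub K(1) by (intro mult_left_mono) auto
      finally show ?thesis by simp
    qed
  qed (rule I)
  also have "\<dots> \<le> c / 2 * exp (2 * K * t)" using I c(1) by simp
  finally show ?thesis .
qed

lemma integral_curve_unique:
  fixes F :: "real \<Rightarrow> 'b::euclidean_space \<Rightarrow> 'b"
  assumes F: "lipschitz_field F" and u: "integral_curve F T x u" and v: "integral_curve F T x v"
    and t: "t \<in> {0..T}"
  shows "u t = v t"
proof -
  obtain K where K: "K > 0" "\<And>t x y. t \<in> {0..T} \<Longrightarrow> norm (F t x - F t y) \<le> K * norm (x - y)"
    using lipschitz_field_bound[OF F] by metis
  note cu = integral_curveD(1)[OF u] integral_curveD(1)[OF v]
    and eq = integral_curveD(2)[OF u] integral_curveD(2)[OF v]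
  have "bounded ((\<lambda>t. u t - v t) ` {0..T})"
    by (intro compact_imp_bounded compact_continuous_image continuous_intros cu) auto
  then obtain M where M: "M > 0" "\<And>t. t \<in> {0..T} \<Longrightarrow> norm (u t - v t) \<le> M"
    unfolding bounded_pos by auto
  have bd: "norm (u t - v t) \<le> M * (1 / 2) ^ n * exp (2 * K * t)" if "t \<in> {0..T}" for n t
    using that
  proof (induction n arbitrary: t)
    case 0
    have "norm (u t - v t) \<le> M * 1" using M 0 by simp
    also have "\<dots> \<le> M * exp (2 * K * t)" using M K 0 by (intro mult_left_mono) auto
    finally show ?case by simp
  next
    case (Suc n)
    have "norm (integral {0..t} (\<lambda>r. F r (u r)) - integral {0..t} (\<lambda>r. F r (v r)))
        \<le> M * (1 / 2) ^ n / 2 * exp (2 * K * t)"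
      using Suc M by (intro integral_curve_contraction[OF F K cu]) auto
    then show ?case using eq[OF Suc.prems] by simp
  qed
  have "(\<lambda>n. M * (1 / 2) ^ n * exp (2 * K * t)) \<longlonglongrightarrow> M * 0 * exp (2 * K * t)"
    by (rule tendsto_mult_right, rule tendsto_mult_left, rule LIMSEQ_power_zero) simp
  then have "norm (u t - v t) \<le> M * 0 * exp (2 * K * t)"
    by (rule LIMSEQ_le_const) (use bd[OF t] in auto)
  then show ?thesis by simp
qed

lemma picard_properties:
  fixes F :: "real \<Rightarrow> 'b::euclidean_space \<Rightarrow> 'b"
  assumes F: "lipschitz_field F"
  shows continuous_picard: "continuous_on {0..T} (picard F x n)"
    and picard_Suc_integral:
      "t \<ge> 0 \<Longrightarrow> picard F x (Suc n) t = x + integral {0..t} (\<lambda>r. F r (picard F x n r))"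
proof -
  have step: "picard F x (Suc n) t = x + integral {0..t} (\<lambda>r. F r (picard F x n r))"
    if "continuous_on {0..t} (picard F x n)" for n t
    using set_borel_integral_eq_integral(2)[OF borel_integrable_atLeastAtMost'
        [OF lipschitz_field_continuous[OF F that]]] by simp
  have cont: "continuous_on {0..T} (picard F x n)" for n T
  proof (induction n arbitrary: T)
    case (Suc n)
    have "continuous_on {0..T} (\<lambda>t. x + integral {0..t} (\<lambda>r. F r (picard F x n r)))"
      by (intro continuous_on_add continuous_on_const continuous_on_integral_upto
          lipschitz_field_continuous[OF F] Suc)
    then show ?case
      by (rule continuous_on_eq) (rule step[OF Suc, symmetric])
  qed simp
  show "continuous_on {0..T} (picard F x n)" by (rule cont)
  show "picard F x (Suc n) t = x + integral {0..t} (\<lambda>r. F r (picard F x n r))" if "t \<ge> 0"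
    by (rule step[OF cont])
qed

lemma picard_uniform_limit:
  fixes F :: "real \<Rightarrow> 'b::euclidean_space \<Rightarrow> 'b"
  assumes F: "lipschitz_field F"
  shows "uniform_limit {0..T} (picard F x) (ode_flow F x) sequentially"
proof -
  obtain K where K: "K > 0" "\<And>t x y. t \<in> {0..T} \<Longrightarrow> norm (F t x - F t y) \<le> K * norm (x - y)"
    using lipschitz_field_bound[OF F] by metis
  note cont = continuous_picard[OF F]
  have "bounded ((\<lambda>t. picard F x 1 t - picard F x 0 t) ` {0..T})"
    by (intro compact_imp_bounded compact_continuous_image continuous_on_diff cont) auto
  then obtain M where M: "M > 0"
    "\<And>t. t \<in> {0..T} \<Longrightarrow> norm (picard F x 1 t - picard F x 0 t) \<le> M"
    unfolding bounded_pos by (auto simp del: picard.simps)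
  \<comment> \<open>The halving makes the series of differences geometric.\<close>
  have bd: "norm (picard F x (Suc n) t - picard F x n t) \<le> M * (1 / 2) ^ n * exp (2 * K * t)"
    if "t \<in> {0..T}" for n t
    using that
  proof (induction n arbitrary: t)
    case 0
    have "norm (picard F x 1 t - picard F x 0 t) \<le> M * 1" using M 0 by (simp del: picard.simps)
    also have "\<dots> \<le> M * exp (2 * K * t)" using M K 0 by (intro mult_left_mono) auto
    finally show ?case by (simp del: picard.simps)
  next
    case (Suc n)
    have "norm (integral {0..t} (\<lambda>r. F r (picard F x (Suc n) r))
                - integral {0..t} (\<lambda>r. F r (picard F x n r)))
        \<le> M * (1 / 2) ^ n / 2 * exp (2 * K * t)"
      using Suc M by (intro integral_curve_contraction[OF F K cont cont]) (auto simp del: picard.simps)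
    then show ?case
      using Suc.prems by (simp add: picard_Suc_integral[OF F] del: picard.simps)
  qed
  define d where "d n t = picard F x (Suc n) t - picard F x n t" for n t
  have "uniform_limit {0..T} (\<lambda>n t. \<Sum>i<n. d i t) (\<lambda>t. \<Sum>i. d i t) sequentially"
  proof (rule Weierstrass_m_test)
    show "norm (d n t) \<le> M * (1 / 2) ^ n * exp (2 * K * T)" if "t \<in> {0..T}" for n t
    proof -
      have "M * (1 / 2) ^ n * exp (2 * K * t) \<le> M * (1 / 2) ^ n * exp (2 * K * T)"
        using that M K by (intro mult_left_mono) auto
      with bd[OF that, of n] show ?thesis unfolding d_def by linarith
    qed
    show "summable (\<lambda>n. M * (1 / 2) ^ n * exp (2 * K * T))"
      by (rule summable_mult2, rule summable_mult, rule summable_geometric) simp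
  qed
  then have "uniform_limit {0..T} (\<lambda>n t. x + (\<Sum>i<n. d i t)) (\<lambda>t. x + (\<Sum>i. d i t)) sequentially"
    by (intro uniform_limit_add uniform_limit_const)
  moreover have "x + (\<Sum>i<n. d i t) = picard F x n t" for n t
    unfolding d_def by (subst sum_lessThan_telescope) simp
  ultimately have lim: "uniform_limit {0..T} (picard F x) (\<lambda>t. x + (\<Sum>i. d i t)) sequentially"
    by simp
  have "ode_flow F x t = x + (\<Sum>i. d i t)" if "t \<in> {0..T}" for t
    unfolding ode_flow_def by (intro limI tendsto_uniform_limitI[OF lim that])
  then show ?thesis
    using lim uniform_limit_cong'[of "{0..T}" "picard F x" "picard F x"
        "ode_flow F x" "\<lambda>t. x + (\<Sum>i. d i t)" sequentially] by auto
qed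

lemma integral_curve_ode_flow:
  fixes F :: "real \<Rightarrow> 'b::euclidean_space \<Rightarrow> 'b"
  assumes F: "lipschitz_field F"
  shows "integral_curve F T x (ode_flow F x)"
proof -
  obtain K where K: "K > 0" "\<And>t x y. t \<in> {0..T} \<Longrightarrow> norm (F t x - F t y) \<le> K * norm (x - y)"
    using lipschitz_field_bound[OF F] by metis
  note cont = continuous_picard[OF F] and lim = picard_uniform_limit[OF F, where T = T and x = x]
  have cf: "continuous_on {0..T} (ode_flow F x)"
    by (rule uniform_limit_theorem[OF _ lim]) (auto intro: always_eventually cont)
  have "ode_flow F x t = x + integral {0..t} (\<lambda>r. F r (ode_flow F x r))" if t: "t \<in> {0..T}" for t
  proof -
    have "(\<lambda>n. integral {0..t} (\<lambda>r. F r (picard F x n r)))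
        \<longlonglongrightarrow> integral {0..t} (\<lambda>r. F r (ode_flow F x r))"
    proof (rule metric_LIMSEQ_I)
      fix e :: real assume "e > 0"
      define c where "c = e / exp (2 * K * t)"
      have "c > 0" using \<open>e > 0\<close> by (simp add: c_def)
      then obtain N where N: "\<And>n r. n \<ge> N \<Longrightarrow> r \<in> {0..T} \<Longrightarrow> dist (picard F x n r) (ode_flow F x r) < c"
        using lim unfolding uniform_limit_sequentially_iff by meson
      have "dist (integral {0..t} (\<lambda>r. F r (picard F x n r)))
                 (integral {0..t} (\<lambda>r. F r (ode_flow F x r))) < e" if "n \<ge> N" for n
      proof -
        have "norm (picard F x n r - ode_flow F x r) \<le> c * exp (2 * K * r)" if r: "r \<in> {0..T}" for r
        proof -
          have "norm (picard F x n r - ode_flow F x r) \<le> c * 1"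
            using N[OF \<open>n \<ge> N\<close> r] by (simp add: dist_norm)
          also have "\<dots> \<le> c * exp (2 * K * r)"
            using \<open>c > 0\<close> K r by (intro mult_left_mono) auto
          finally show ?thesis .
        qed
        then have "norm (integral {0..t} (\<lambda>r. F r (picard F x n r))
                  - integral {0..t} (\<lambda>r. F r (ode_flow F x r))) \<le> c / 2 * exp (2 * K * t)"
          using \<open>c > 0\<close> t by (intro integral_curve_contraction[OF F K cont cf]) auto
        also have "\<dots> < e" using \<open>e > 0\<close> by (simp add: c_def)
        finally show ?thesis by (simp add: dist_norm)
      qed
      then show "\<exists>N. \<forall>n\<ge>N. dist (integral {0..t} (\<lambda>r. F r (picard F x n r)))
                 (integral {0..t} (\<lambda>r. F r (ode_flow F x r))) < e" by blast
    qed
    then have "(\<lambda>n. picard F x (Suc n) t) \<longlonglongrightarrow> x + integral {0..t} (\<lambda>r. F r (ode_flow F x r))"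
      using t by (simp add: picard_Suc_integral[OF F] tendsto_add del: picard.simps)
    moreover have "(\<lambda>n. picard F x (Suc n) t) \<longlonglongrightarrow> ode_flow F x t"
      using tendsto_uniform_limitI[OF lim t] by (rule LIMSEQ_Suc)
    ultimately show ?thesis by (rule LIMSEQ_unique[symmetric])
  qed
  with cf show ?thesis unfolding integral_curve_def by blast
qed

lemma ode_flow_0: "lipschitz_field F \<Longrightarrow> ode_flow F x 0 = x"
  using integral_curve_ode_flow[of F 0 x] unfolding integral_curve_def by simp

text \<open>The restarted curve solves the shifted equation, whose solution is unique.\<close>

lemma ode_flow_shift:
  fixes F :: "real \<Rightarrow> 'b::euclidean_space \<Rightarrow> 'b"
  assumes F: "lipschitz_field F" and G: "lipschitz_field G"
    and shift: "\<And>r x. G r x = F (r + s) x" and s: "s \<ge> 0" and t: "t \<ge> 0"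
  shows "ode_flow F x (s + t) = ode_flow G (ode_flow F x s) t"
proof -
  let ?y = "ode_flow F x"
  note y = integral_curveD[OF integral_curve_ode_flow[OF F, of "s + t" x]]
  have int: "(\<lambda>r. F r (?y r)) integrable_on {a..b}" if "0 \<le> a" "b \<le> s + t" for a b
    by (rule integrable_continuous_real,
        rule continuous_on_subset[OF lipschitz_field_continuous[OF F y(1)]]) (use that in auto)
  have "integral_curve G t (?y s) (\<lambda>r. ?y (s + r))"
    unfolding integral_curve_def
  proof (intro conjI ballI)
    show "continuous_on {0..t} (\<lambda>r. ?y (s + r))"
      by (rule continuous_on_compose2[OF y(1)], intro continuous_intros) (use s in auto)
    fix r assume r: "r \<in> {0..t}"
    have "((\<lambda>q. F q (?y q)) has_integral integral {s..s + r} (\<lambda>q. F q (?y q))) {s..s + r}"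
      by (intro integrable_integral int) (use s r in auto)
    then have "((\<lambda>q. F (q + s) (?y (q + s))) has_integral integral {s..s + r} (\<lambda>q. F q (?y q)))
        {s - s..s + r - s}"
      by (rule has_integral_shift_real_ivl)
    then have "integral {0..r} (\<lambda>q. G q (?y (s + q))) = integral {s..s + r} (\<lambda>q. F q (?y q))"
      by (intro integral_unique) (simp only: shift add.commute[of _ s] diff_self add_diff_cancel_left')
    moreover have "integral {0..s} (\<lambda>q. F q (?y q)) + integral {s..s + r} (\<lambda>q. F q (?y q))
        = integral {0..s + r} (\<lambda>q. F q (?y q))"
      by (rule Henstock_Kurzweil_Integration.integral_combine) (use s r in \<open>auto intro!: int\<close>)
    ultimately show "?y (s + r) = ?y s + integral {0..r} (\<lambda>q. G q (?y (s + q)))"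
      using y(2)[of s] y(2)[of "s + r"] s r t by (simp add: add.assoc)
  qed
  from integral_curve_unique[OF G this integral_curve_ode_flow[OF G], of t] t
  show ?thesis by simp
qed

lemma measurable_ode_flow:
  fixes F :: "'w \<Rightarrow> real \<Rightarrow> 'b::euclidean_space \<Rightarrow> 'b"
  assumes F: "(\<lambda>(\<omega>, r, y). F \<omega> r y) \<in> borel_measurable (M \<Otimes>\<^sub>M (borel \<Otimes>\<^sub>M borel))"
  shows "(\<lambda>(t, \<omega>, x). ode_flow (F \<omega>) x t) \<in> borel_measurable (borel \<Otimes>\<^sub>M (M \<Otimes>\<^sub>M borel))"
proof -
  let ?N = "borel \<Otimes>\<^sub>M (M \<Otimes>\<^sub>M borel) :: (real \<times> 'w \<times> 'b) measure"
  have pic: "(\<lambda>(t, \<omega>, x). picard (F \<omega>) x n t) \<in> borel_measurable ?N" for n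
  proof (induction n)
    case (Suc n)
    \<comment> \<open>\<open>z\<close> is the triple of time, parameter and starting point, paired with the integration variable.\<close>
    have m: "(\<lambda>z. picard (F (fst (snd (fst z)))) (snd (snd (fst z))) n (snd z))
              \<in> borel_measurable (?N \<Otimes>\<^sub>M lborel)"
      using measurable_compose[OF _ Suc[unfolded case_prod_beta],
          of "\<lambda>z. (snd z, fst (snd (fst z)), snd (snd (fst z)))" "?N \<Otimes>\<^sub>M lborel"]
      by simp
    have "(\<lambda>z. F (fst (snd (fst z))) (snd z)
               (picard (F (fst (snd (fst z)))) (snd (snd (fst z))) n (snd z)))
              \<in> borel_measurable (?N \<Otimes>\<^sub>M lborel)"
      using measurable_compose[OF _ F[unfolded case_prod_beta], of "\<lambda>z. (fst (snd (fst z)), snd z,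
               picard (F (fst (snd (fst z)))) (snd (snd (fst z))) n (snd z))" "?N \<Otimes>\<^sub>M lborel"] m
      by simp
    then have "(\<lambda>z. (if 0 \<le> snd z \<and> snd z \<le> fst (fst z) then 1 else 0 :: real) *\<^sub>R
               F (fst (snd (fst z))) (snd z)
               (picard (F (fst (snd (fst z)))) (snd (snd (fst z))) n (snd z)))
              \<in> borel_measurable (?N \<Otimes>\<^sub>M lborel)"
      by measurable
    then have "(\<lambda>p. snd (snd p) + (LINT r|lborel. (if 0 \<le> r \<and> r \<le> fst p then 1 else 0 :: real) *\<^sub>R
               F (fst (snd p)) r (picard (F (fst (snd p))) (snd (snd p)) n r)))
              \<in> borel_measurable ?N"
      by (intro borel_measurable_add lborel.borel_measurable_lebesgue_integral)
         (auto simp: case_prod_beta)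
    then show ?case
      by (simp add: case_prod_beta set_lebesgue_integral_def indicator_def of_bool_def)
  qed simp
  then show ?thesis
    using borel_measurable_lim_metric[OF pic] by (simp add: ode_flow_def case_prod_beta)
qed

section \<open>Bounds for matrices, tensors and the coefficient of the second level\<close>

lemma norm_matrix_vector_le:
  fixes A :: "real ^ 'n ^ 'm"
  shows "norm (A *v x) \<le> norm A * norm x"
proof -
  have "norm (A *v x) = L2_set (\<lambda>i. \<bar>A $ i \<bullet> x\<bar>) UNIV"
    by (simp add: norm_vec_def matrix_vector_mult_def inner_vec_def)
  also have "\<dots> \<le> L2_set (\<lambda>i. norm (A $ i) * norm x) UNIV"
    by (intro L2_set_mono Cauchy_Schwarz_ineq2) auto
  also have "\<dots> = norm A * norm x"
    by (simp add: norm_vec_def[of A] L2_set_left_distrib)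
  finally show ?thesis .
qed

lemma bounded_bilinear_matrix_vector:
  "bounded_bilinear ((*v) :: real ^ 'n ^ 'm \<Rightarrow> real ^ 'n \<Rightarrow> real ^ 'm)"
proof
  show "\<exists>K. \<forall>(A :: real ^ 'n ^ 'm) x. norm (A *v x) \<le> norm A * norm x * K"
    by (rule exI[of _ 1]) (simp add: norm_matrix_vector_le)
qed (simp_all add: matrix_vector_mult_add_rdistrib matrix_vector_right_distrib
    scaleR_matrix_vector_assoc matrix_vector_mult_scaleR)

lemma continuous_on_matrix_vector [continuous_intros]:
  fixes A :: "'a::topological_space \<Rightarrow> real ^ 'n ^ 'm"
  shows "continuous_on S A \<Longrightarrow> continuous_on S x \<Longrightarrow> continuous_on S (\<lambda>t. A t *v x t)"
  by (rule bounded_bilinear.continuous_on[OF bounded_bilinear_matrix_vector])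

lemma norm_tensor: "norm (tensor a b) = norm a * norm b"
proof -
  have row: "tensor a b $ i = a $ i *\<^sub>R b" for i
    by (simp add: tensor_def vec_eq_iff)
  have "norm (tensor a b) = L2_set (\<lambda>i. norm (a $ i) * norm b) UNIV"
    by (simp add: norm_vec_def[of "tensor a b"] row)
  also have "\<dots> = norm a * norm b"
    by (simp add: norm_vec_def[of a] L2_set_left_distrib)
  finally show ?thesis .
qed

lemma bounded_bilinear_tensor:
  "bounded_bilinear (tensor :: real ^ 'd \<Rightarrow> real ^ 'd \<Rightarrow> real ^ 'd ^ 'd)"
proof
  show "\<exists>K. \<forall>(a :: real ^ 'd) b. norm (tensor a b) \<le> norm a * norm b * K"
    by (rule exI[of _ 1]) (simp add: norm_tensor)
qed (simp_all add: tensor_def vec_eq_iff algebra_simps)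

lemma Cb3_bounds:
  assumes "Cb3 g"
  obtains B where "B \<ge> 0" "\<And>y. norm (g y) \<le> B"
    "\<And>x y. norm (g x - g y) \<le> B * norm (x - y)"
    "\<And>y v. norm (frechet_derivative g (at y) v) \<le> B * norm v"
proof -
  from assms obtain D1 where D1: "\<And>x. (g has_derivative blinfun_apply (D1 x)) (at x)"
    and "bounded (range g)" "bounded (range D1)"
    unfolding Cb3_def by blast
  then obtain B1 B2 where B: "\<And>y. norm (g y) \<le> B1" "\<And>y. norm (D1 y) \<le> B2"
    unfolding bounded_iff by auto
  define B where "B = max B1 B2"
  have BB: "norm (g y) \<le> B" "norm (D1 y) \<le> B" for y
    using B[of y] by (auto simp: B_def)
  show ?thesis
  proof (rule that)
    show "B \<ge> 0" using BB(1)[of undefined] norm_ge_zero order_trans by blast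
    show "norm (g y) \<le> B" for y by (rule BB)
    show "norm (g x - g y) \<le> B * norm (x - y)" for x y
      by (rule differentiable_bound[of UNIV g "\<lambda>x. blinfun_apply (D1 x)"])
         (use D1 BB(2) in \<open>auto simp: norm_blinfun.rep_eq[symmetric]\<close>)
    show "norm (frechet_derivative g (at y) v) \<le> B * norm v" for y v
      using norm_blinfun[of "D1 y" v] mult_right_mono[OF BB(2)[of y] norm_ge_zero[of v]]
      by (simp add: frechet_derivative_at[OF D1, symmetric])
  qed
qed

lemma continuous_on_Cb3:
  assumes "Cb3 g"
  shows "continuous_on S g"
proof -
  obtain B where "B \<ge> 0" "\<And>x y. norm (g x - g y) \<le> B * norm (x - y)"
    using Cb3_bounds[OF assms] by metis
  then have "B-lipschitz_on S g"
    by (auto simp: lipschitz_on_def dist_norm)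
  then show ?thesis by (rule lipschitz_on_continuous_on)
qed

lemma Dgg_bound:
  fixes g :: "real ^ 'm \<Rightarrow> real ^ 'd ^ 'm"
  assumes "Cb3 g"
  obtains D where "D \<ge> 0" "\<And>y N. norm (Dgg g y N) \<le> D * norm N"
proof -
  obtain B where B: "B \<ge> 0" "\<And>y. norm (g y) \<le> B"
    "\<And>y v. norm (frechet_derivative g (at y) v) \<le> B * norm v"
    using Cb3_bounds[OF assms] by metis
  have "norm (Dgg g y N) \<le> (CARD('d) * CARD('d) * (B * B)) * norm N" for y and N :: "real ^ 'd ^ 'd"
  proof -
    have t: "norm ((N $ k $ j) *\<^sub>R (frechet_derivative g (at y) (g y *v axis k 1) *v axis j 1))
        \<le> norm N * (B * B)" for k j
    proof -
      have "\<bar>N $ k $ j\<bar> \<le> norm N"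
        using component_le_norm_cart[of "N $ k" j] Finite_Cartesian_Product.norm_nth_le[of N k] by linarith
      moreover have "norm (g y *v axis k 1) \<le> B"
        using norm_matrix_vector_le[of "g y" "axis k 1"] B(2)[of y] by simp
      then have "norm (frechet_derivative g (at y) (g y *v axis k 1)) \<le> B * B"
        using B(3)[of y "g y *v axis k 1"] mult_left_mono[OF _ B(1)] order_trans by blast
      then have "norm (frechet_derivative g (at y) (g y *v axis k 1) *v axis j 1) \<le> B * B"
        using norm_matrix_vector_le[of "frechet_derivative g (at y) (g y *v axis k 1)" "axis j 1"]
        by simp
      ultimately show ?thesis by (simp add: mult_mono)
    qed
    have "norm (Dgg g y N) \<le> (\<Sum>k\<in>(UNIV::'d set). \<Sum>j\<in>(UNIV::'d set). norm N * (B * B))"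
      unfolding Dgg_def by (intro sum_norm_le t)
    then show ?thesis by (simp add: mult_ac)
  qed
  moreover have "CARD('d) * CARD('d) * (B * B) \<ge> 0" using B by simp
  ultimately show ?thesis using that by blast
qed

section \<open>Rough integrals against smooth drivers\<close>

text \<open>Only the size of \<open>XX\<close> is recorded, not that it is an iterated integral: compensating
  terms of quadratic size disappear from the compensated Riemann sums in the limit.\<close>

definition smooth_lift ::
  "real \<Rightarrow> (real \<Rightarrow> real ^ 'd) \<Rightarrow> (real \<Rightarrow> real ^ 'd) \<Rightarrow> (real \<Rightarrow> real \<Rightarrow> real ^ 'd ^ 'd) \<Rightarrow> bool" where
  "smooth_lift T w X XX \<longleftrightarrow>
     continuous_on {0..T} w \<and>
     (\<forall>u v. 0 \<le> u \<and> u \<le> v \<and> v \<le> T \<longrightarrow> (w has_integral incr X u v) {u..v}) \<and>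
     (\<exists>C\<ge>0. \<forall>u v. 0 \<le> u \<and> u \<le> v \<and> v \<le> T \<longrightarrow> norm (XX u v) \<le> C * (v - u)\<^sup>2)"

text \<open>Over an interval of a fine partition, freezing \<open>g (y r)\<close> at the left endpoint costs little by
  uniform continuity, and the second-level term is at most a constant times mesh times length. Each of the
  two errors gets half of \<open>\<mu>\<close> times the length, and the lengths add up to \<open>t - s\<close>.\<close>

lemma has_rough_integral_smooth:
  fixes g :: "real ^ 'm \<Rightarrow> real ^ 'd ^ 'm"
  assumes lift: "smooth_lift T w X XX" and g: "Cb3 g" and y: "continuous_on {0..T} y"
    and st: "0 \<le> s" "s \<le> t" "t \<le> T"
  shows "has_rough_integral g X XX y s t (integral {s..t} (\<lambda>r. g (y r) *v w r))"
  unfolding has_rough_integral_def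
proof (intro allI impI)
  fix \<epsilon> :: real assume "\<epsilon> > 0"
  have w: "continuous_on {0..T} w"
    and X: "\<And>u v. 0 \<le> u \<Longrightarrow> u \<le> v \<Longrightarrow> v \<le> T \<Longrightarrow> (w has_integral incr X u v) {u..v}"
    using lift unfolding smooth_lift_def by blast+
  obtain C where C: "C \<ge> 0"
    "\<And>u v. 0 \<le> u \<Longrightarrow> u \<le> v \<Longrightarrow> v \<le> T \<Longrightarrow> norm (XX u v) \<le> C * (v - u)\<^sup>2"
    using lift unfolding smooth_lift_def by blast
  obtain D where D: "D \<ge> 0" "\<And>y N. norm (Dgg g y N) \<le> D * norm N"
    using Dgg_bound[OF g] by metis
  have gc: "continuous_on {0..T} (\<lambda>r. g (y r))"
    using continuous_on_compose2[OF continuous_on_Cb3[OF g, of UNIV] y] by simp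
  have "bounded (w ` {0..T})"
    by (intro compact_imp_bounded compact_continuous_image w) auto
  then obtain B where B: "B > 0" "\<And>r. r \<in> {0..T} \<Longrightarrow> norm (w r) \<le> B"
    unfolding bounded_pos by auto
  \<comment> \<open>The summand one covers \<open>s = t\<close>.\<close>
  define \<mu> where "\<mu> = \<epsilon> / (2 * (t - s + 1))"
  have "\<mu> > 0" using \<open>\<epsilon> > 0\<close> st by (simp add: \<mu>_def)
  have "uniformly_continuous_on {0..T} (\<lambda>r. g (y r))"
    by (intro compact_uniformly_continuous gc) auto
  moreover have "\<mu> / (2 * B) > 0" using \<open>\<mu> > 0\<close> B by simp
  ultimately obtain \<eta>1 where \<eta>1: "\<eta>1 > 0"
    "\<And>q r. q \<in> {0..T} \<Longrightarrow> r \<in> {0..T} \<Longrightarrow> dist r q < \<eta>1 \<Longrightarrow> dist (g (y r)) (g (y q)) < \<mu> / (2 * B)"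
    unfolding uniformly_continuous_on_def by metis
  define \<eta> where "\<eta> = min \<eta>1 (\<mu> / (2 * (D * C + 1)))"
  have DC: "D * C \<ge> 0" using D C by simp
  have "\<eta> > 0" using \<eta>1 \<open>\<mu> > 0\<close> DC by (simp add: \<eta>_def)
  have h: "continuous_on {0..T} (\<lambda>r. g (y r) *v w r)"
    by (intro continuous_intros gc w)
  define S where "S K = g (y (Inf K)) *v incr X (Inf K) (Sup K)
      + Dgg g (y (Inf K)) (XX (Inf K) (Sup K))" for K
  have "norm ((\<Sum>K\<in>P. S K) - integral {s..t} (\<lambda>r. g (y r) *v w r)) < \<epsilon>"
    if P: "P division_of {s..t}" and fine: "\<And>K. K \<in> P \<Longrightarrow> Sup K - Inf K < \<eta>" for P
  proof -
    have loc: "norm (S K - integral K (\<lambda>r. g (y r) *v w r)) \<le> \<mu> * measure lborel K" if K: "K \<in> P" for K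
    proof -
      from division_ofD(2-4)[OF P K] obtain u v where uv: "K = {u..v}" "K \<noteq> {}" "K \<subseteq> {s..t}"
        by (auto simp: cbox_interval)
      then have le: "u \<le> v" "0 \<le> u" "v \<le> T" using st by auto
      have sub: "{u..v} \<subseteq> {0..T}" using le by auto
      have len: "v - u < \<eta>" using fine[OF K] uv le by simp
      have hi: "(\<lambda>r. g (y r) *v w r) integrable_on {u..v}" "w integrable_on {u..v}"
        by (intro integrable_continuous_real continuous_on_subset[OF _ sub] h w)+
      have lin: "g (y u) *v incr X u v = integral {u..v} (\<lambda>r. g (y u) *v w r)"
        using integral_linear[OF hi(2) matrix_vector_mul_bounded_linear[of "g (y u)"]]
          X[OF le(2,1,3)] by (simp add: o_def integral_unique)
      have cu: "continuous_on {u..v} (\<lambda>r. g (y u) *v w r)"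
        by (intro continuous_intros continuous_on_subset[OF w sub])
      have "norm (g (y u) *v incr X u v - integral {u..v} (\<lambda>r. g (y r) *v w r))
          = norm (integral {u..v} (\<lambda>r. (g (y u) - g (y r)) *v w r))"
        unfolding lin
        by (subst integral_diff[symmetric])
           (use hi cu in \<open>auto intro: integrable_continuous_real simp: matrix_vector_mult_diff_rdistrib\<close>)
      also have "\<dots> \<le> \<mu> / 2 * (v - u)"
      proof (rule integral_bound[OF le(1)])
        show "continuous_on {u..v} (\<lambda>r. (g (y u) - g (y r)) *v w r)"
          by (intro continuous_intros continuous_on_subset[OF w sub] continuous_on_subset[OF gc sub])
        fix r assume r: "r \<in> {u..v}"
        have "norm (g (y u) - g (y r)) < \<mu> / (2 * B)"
          using \<eta>1(2)[of r u] r len le sub by (auto simp: dist_norm \<eta>_def)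
        moreover have "norm (w r) \<le> B" using B(2) r sub by blast
        ultimately have "norm (g (y u) - g (y r)) * norm (w r) \<le> \<mu> / (2 * B) * B"
          by (intro mult_mono) (use \<open>\<mu> > 0\<close> B in auto)
        then show "norm ((g (y u) - g (y r)) *v w r) \<le> \<mu> / 2"
          using norm_matrix_vector_le[of "g (y u) - g (y r)" "w r"] B by simp
      qed
      finally have 1: "norm (g (y u) *v incr X u v - integral {u..v} (\<lambda>r. g (y r) *v w r))
          \<le> \<mu> / 2 * (v - u)" .
      have "norm (Dgg g (y u) (XX u v)) \<le> D * (C * (v - u)\<^sup>2)"
        using D(2)[of "y u" "XX u v"] mult_left_mono[OF C(2)[OF le(2,1,3)] D(1)] by linarith
      also have "\<dots> = (D * C) * (v - u) * (v - u)" by (simp add: power2_eq_square)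
      also have "\<dots> \<le> \<mu> / 2 * (v - u)"
      proof (rule mult_right_mono)
        have "(D * C) * (v - u) \<le> (D * C + 1) * (\<mu> / (2 * (D * C + 1)))"
          by (intro mult_mono) (use len DC le in \<open>auto simp: \<eta>_def\<close>)
        also have "\<dots> = \<mu> / 2" using DC by (simp add: field_simps)
        finally show "(D * C) * (v - u) \<le> \<mu> / 2" .
      qed (use le in simp)
      finally have 2: "norm (Dgg g (y u) (XX u v)) \<le> \<mu> / 2 * (v - u)" .
      have "norm (S K - integral K (\<lambda>r. g (y r) *v w r))
          = norm ((g (y u) *v incr X u v - integral {u..v} (\<lambda>r. g (y r) *v w r))
            + Dgg g (y u) (XX u v))"
        using uv le by (simp add: S_def algebra_simps)
      also have "\<dots> \<le> \<mu> / 2 * (v - u) + \<mu> / 2 * (v - u)"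
        using norm_triangle_mono[OF 1 2] .
      also have "\<dots> = \<mu> * measure lborel K" using uv le by (simp add: algebra_simps)
      finally show ?thesis .
    qed
    have "integral {s..t} (\<lambda>r. g (y r) *v w r) = (\<Sum>K\<in>P. integral K (\<lambda>r. g (y r) *v w r))"
      by (rule integral_combine_division_topdown[OF _ P], rule integrable_continuous_real,
          rule continuous_on_subset[OF h]) (use st in auto)
    then have "norm ((\<Sum>K\<in>P. S K) - integral {s..t} (\<lambda>r. g (y r) *v w r))
        = norm (\<Sum>K\<in>P. S K - integral K (\<lambda>r. g (y r) *v w r))"
      by (simp add: sum_subtractf)
    also have "\<dots> \<le> (\<Sum>K\<in>P. \<mu> * measure lborel K)"
      by (intro sum_norm_le loc)
    also have "\<dots> = \<mu> * (t - s)"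
      using additive_content_division[of P s t] P st
      by (simp add: sum_distrib_left[symmetric] cbox_interval)
    also have "\<dots> < \<epsilon>"
    proof -
      have "\<epsilon> * (t - s) < \<epsilon> * (2 * (t - s + 1))"
        using st \<open>\<epsilon> > 0\<close> by (intro mult_strict_left_mono) auto
      then show ?thesis using st by (simp add: \<mu>_def field_simps)
    qed
    finally show ?thesis .
  qed
  with \<open>\<eta> > 0\<close> show "\<exists>\<eta>>0. \<forall>P. P division_of {s..t} \<and> (\<forall>K\<in>P. Sup K - Inf K < \<eta>) \<longrightarrow>
      norm ((\<Sum>K\<in>P. g (y (Inf K)) *v incr X (Inf K) (Sup K) +
                      Dgg g (y (Inf K)) (XX (Inf K) (Sup K)))
            - integral {s..t} (\<lambda>r. g (y r) *v w r)) < \<epsilon>"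
    unfolding S_def by blast
qed

lemma exists_fine_division:
  fixes s t \<eta> :: real
  assumes "\<eta> > 0"
  obtains P where "P division_of {s..t}" "\<And>K. K \<in> P \<Longrightarrow> Sup K - Inf K < \<eta>"
proof -
  obtain p where p: "p tagged_division_of {s..t}" "(\<lambda>x. ball x (\<eta> / 2)) fine p"
    using fine_division_exists_real[OF gauge_ball, of "\<eta> / 2"] assms by auto
  show ?thesis
  proof (rule that[OF division_of_tagged_division[OF p(1)]])
    fix K assume "K \<in> snd ` p"
    then obtain x where x: "(x, K) \<in> p" by auto
    then obtain u v where uv: "K = {u..v}" "x \<in> K"
      using tagged_division_ofD(2,4)[OF p(1) x] by (auto simp: cbox_interval)
    have "K \<subseteq> ball x (\<eta> / 2)" using p(2) x by (auto simp: fine_def)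
    then have "\<forall>r\<in>{u..v}. \<bar>x - r\<bar> < \<eta> / 2"
      unfolding uv(1) by (simp only: subset_eq mem_ball dist_real_def)
    from bspec[OF this, of u] bspec[OF this, of v]
    have "\<bar>x - u\<bar> < \<eta> / 2" "\<bar>x - v\<bar> < \<eta> / 2"
      using uv by auto
    then show "Sup K - Inf K < \<eta>" using uv by simp
  qed
qed

lemma has_rough_integral_unique:
  assumes I: "has_rough_integral g X XX y s t I" and J: "has_rough_integral g X XX y s t J"
  shows "I = J"
proof (rule ccontr)
  assume "I \<noteq> J"
  define \<epsilon> where "\<epsilon> = norm (I - J) / 2"
  define S where "S P = (\<Sum>K\<in>P. g (y (Inf K)) *v incr X (Inf K) (Sup K) +
                       Dgg g (y (Inf K)) (XX (Inf K) (Sup K)))" for P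
  have "\<epsilon> > 0" using \<open>I \<noteq> J\<close> by (simp add: \<epsilon>_def)
  obtain \<eta>1 where 1: "\<eta>1 > 0" "\<And>P. P division_of {s..t} \<Longrightarrow> (\<And>K. K \<in> P \<Longrightarrow> Sup K - Inf K < \<eta>1)
      \<Longrightarrow> norm (S P - I) < \<epsilon>"
    using I \<open>\<epsilon> > 0\<close> unfolding has_rough_integral_def S_def by meson
  obtain \<eta>2 where 2: "\<eta>2 > 0" "\<And>P. P division_of {s..t} \<Longrightarrow> (\<And>K. K \<in> P \<Longrightarrow> Sup K - Inf K < \<eta>2)
      \<Longrightarrow> norm (S P - J) < \<epsilon>"
    using J \<open>\<epsilon> > 0\<close> unfolding has_rough_integral_def S_def by meson
  obtain P where P: "P division_of {s..t}" "\<And>K. K \<in> P \<Longrightarrow> Sup K - Inf K < min \<eta>1 \<eta>2"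
    using exists_fine_division[of "min \<eta>1 \<eta>2" s t] 1 2 by auto
  have "norm (S P - I) < \<epsilon>" "norm (S P - J) < \<epsilon>"
    using 1(2)[OF P(1)] 2(2)[OF P(1)] P(2) by auto
  moreover have "norm (I - J) \<le> norm (S P - J) + norm (S P - I)"
    using norm_triangle_ineq4[of "S P - J" "S P - I"] by simp
  ultimately show False by (simp add: \<epsilon>_def)
qed

section \<open>Rough differential equations with smooth drivers are ordinary ones\<close>

definition rde_field ::
  "real ^ 'm ^ 'm \<Rightarrow> (real ^ 'm \<Rightarrow> real ^ 'm) \<Rightarrow> (real ^ 'm \<Rightarrow> real ^ 'd ^ 'm) \<Rightarrow>
     (real \<Rightarrow> real ^ 'd) \<Rightarrow> real \<Rightarrow> real ^ 'm \<Rightarrow> real ^ 'm" where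
  "rde_field A f g w t x = A *v x + f x + g x *v w t"

lemma continuous_on_rde_field:
  assumes "continuous_on UNIV f" "Cb3 g" "continuous_on S w" "continuous_on S y"
  shows "continuous_on S (\<lambda>t. rde_field A f g w t (y t))"
  unfolding rde_field_def
  by (intro continuous_intros assms continuous_on_compose2[OF assms(1,4)]
      continuous_on_compose2[OF continuous_on_Cb3[OF assms(2), of UNIV] assms(4)]) auto

lemma lipschitz_field_rde_field:
  fixes g :: "real ^ 'm \<Rightarrow> real ^ 'd ^ 'm"
  assumes f: "C-lipschitz_on UNIV f" and g: "Cb3 g" and w: "continuous_on UNIV w"
  shows "lipschitz_field (rde_field A f g w)"
  unfolding lipschitz_field_def
proof (intro conjI allI impI)
  show "continuous_on {0..T} (\<lambda>t. rde_field A f g w t (u t))" if "continuous_on {0..T} u" for T u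
    by (intro continuous_on_rde_field lipschitz_on_continuous_on[OF f] g that
        continuous_on_subset[OF w]) auto
  fix T :: real
  obtain G where G: "G \<ge> 0" "\<And>x y. norm (g x - g y) \<le> G * norm (x - y)"
    using Cb3_bounds[OF g] by metis
  have "bounded (w ` {0..T})"
    by (intro compact_imp_bounded compact_continuous_image continuous_on_subset[OF w]) auto
  then obtain B where B: "B > 0" "\<And>r. r \<in> {0..T} \<Longrightarrow> norm (w r) \<le> B"
    unfolding bounded_pos by auto
  define K where "K = norm A + C + G * B + 1"
  have "C \<ge> 0" using f by (rule lipschitz_on_nonneg)
  have "K > 0" using \<open>C \<ge> 0\<close> G B by (simp add: K_def add_nonneg_pos)
  moreover have "norm (rde_field A f g w t x - rde_field A f g w t y) \<le> K * norm (x - y)"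
    if t: "t \<in> {0..T}" for t x y
  proof -
    have "rde_field A f g w t x - rde_field A f g w t y
        = A *v (x - y) + (f x - f y) + (g x - g y) *v w t"
      by (simp add: rde_field_def matrix_vector_mult_diff_distrib matrix_vector_mult_diff_rdistrib)
    moreover have "norm (A *v (x - y)) \<le> norm A * norm (x - y)"
      by (rule norm_matrix_vector_le)
    moreover have "norm (f x - f y) \<le> C * norm (x - y)"
      using lipschitz_onD[OF f, of x y] by (simp add: dist_norm)
    moreover have "norm ((g x - g y) *v w t) \<le> G * norm (x - y) * B"
      by (rule order_trans[OF norm_matrix_vector_le])
         (intro mult_mono G B(2) t mult_nonneg_nonneg norm_ge_zero)
    ultimately have "norm (rde_field A f g w t x - rde_field A f g w t y)
        \<le> norm A * norm (x - y) + C * norm (x - y) + G * norm (x - y) * B"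
      by (simp only:) (intro norm_triangle_mono)
    also have "\<dots> \<le> K * norm (x - y)" by (simp add: K_def algebra_simps)
    finally show ?thesis .
  qed
  ultimately show "\<exists>K>0. \<forall>t\<in>{0..T}. \<forall>x y.
      norm (rde_field A f g w t x - rde_field A f g w t y) \<le> K * norm (x - y)" by blast
qed

lemma holder_if_lipschitz:
  assumes F: "\<And>s t. s \<in> {a..b} \<Longrightarrow> t \<in> {a..b} \<Longrightarrow> norm (F s t) \<le> C * \<bar>t - s\<bar>"
    and C: "C \<ge> 0" and \<gamma>: "0 < \<gamma>" "\<gamma> \<le> 1"
  shows "holder \<gamma> {a..b} F"
  unfolding holder_def
proof (intro exI ballI)
  fix s t assume st: "s \<in> {a..b}" "t \<in> {a..b}"
  have "\<bar>t - s\<bar> = \<bar>t - s\<bar> powr (1 - \<gamma>) * \<bar>t - s\<bar> powr \<gamma>"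
    by (cases "t = s") (simp_all flip: powr_add)
  also have "\<dots> \<le> \<bar>b - a\<bar> powr (1 - \<gamma>) * \<bar>t - s\<bar> powr \<gamma>"
    using st \<gamma> by (intro mult_right_mono powr_mono2) auto
  finally have "C * \<bar>t - s\<bar> \<le> C * (\<bar>b - a\<bar> powr (1 - \<gamma>) * \<bar>t - s\<bar> powr \<gamma>)"
    using C by (rule mult_left_mono)
  with F[OF st] show "norm (F s t) \<le> C * \<bar>b - a\<bar> powr (1 - \<gamma>) * \<bar>t - s\<bar> powr \<gamma>"
    by (simp add: mult.assoc)
qed

lemma holder_incr_continuous:
  assumes "holder \<beta> S (incr y)" and "\<beta> > 0"
  shows "continuous_on S y"
  unfolding continuous_on_def
proof
  fix s assume s: "s \<in> S"
  obtain C where C: "\<And>s t. s \<in> S \<Longrightarrow> t \<in> S \<Longrightarrow> norm (y t - y s) \<le> C * \<bar>t - s\<bar> powr \<beta>"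
    using assms(1) unfolding holder_def incr_def by blast
  have "((\<lambda>t. \<bar>t - s\<bar>) \<longlongrightarrow> 0) (at s within S)"
    using tendsto_rabs_zero[OF LIM_zero[OF tendsto_ident_at]] .
  then have "((\<lambda>t. \<bar>t - s\<bar> powr \<beta>) \<longlongrightarrow> 0 powr \<beta>) (at s within S)"
    by (intro tendsto_powr' tendsto_const) (use assms(2) in auto)
  then have "((\<lambda>t. C * \<bar>t - s\<bar> powr \<beta>) \<longlongrightarrow> 0) (at s within S)"
    using tendsto_mult_left[of _ "0 powr \<beta>" _ C] by simp
  then have "((\<lambda>t. y t - y s) \<longlongrightarrow> 0) (at s within S)"
    by (rule Lim_null_comparison[rotated])
       (simp add: eventually_at_filter C s)
  then show "(y \<longlongrightarrow> y s) (at s within S)"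
    by (rule LIM_zero_cancel)
qed

lemma incr_lipschitz_if_integral:
  fixes y :: "real \<Rightarrow> 'b::euclidean_space"
  assumes h: "continuous_on {a..b} h"
    and y: "\<And>s t. a \<le> s \<Longrightarrow> s \<le> t \<Longrightarrow> t \<le> b \<Longrightarrow> incr y s t = integral {s..t} h"
  obtains M where "M \<ge> 0" "\<And>s t. s \<in> {a..b} \<Longrightarrow> t \<in> {a..b} \<Longrightarrow> norm (incr y s t) \<le> M * \<bar>t - s\<bar>"
proof -
  have "bounded (h ` {a..b})"
    by (intro compact_imp_bounded compact_continuous_image h) auto
  then obtain M where M: "M > 0" "\<And>r. r \<in> {a..b} \<Longrightarrow> norm (h r) \<le> M"
    unfolding bounded_pos by auto
  have le: "norm (incr y s t) \<le> M * (t - s)" if "a \<le> s" "s \<le> t" "t \<le> b" for s t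
    unfolding y[OF that]
    by (rule integral_bound) (use that M in \<open>auto intro: continuous_on_subset[OF h]\<close>)
  show ?thesis
  proof (rule that)
    show "M \<ge> 0" using M by simp
    fix s t assume st: "s \<in> {a..b}" "t \<in> {a..b}"
    show "norm (incr y s t) \<le> M * \<bar>t - s\<bar>"
      using le[of s t] le[of t s] st by (cases "s \<le> t") (auto simp: incr_def norm_minus_commute)
  qed
qed

text \<open>From left to right
  it uses only that a solution is continuous: the compensated Riemann sums then converge to
  an ordinary integral, and limits are unique. Conversely an integral curve is Lipschitz, hence
  Hoelder with every exponent up to one, and so is its remainder.\<close>

lemma rde_solution_smooth_iff:
  fixes g :: "real ^ 'm \<Rightarrow> real ^ 'd ^ 'm"
  assumes lift: "smooth_lift T w X XX" and f: "continuous_on UNIV f" and g: "Cb3 g"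
    and \<beta>: "0 < \<beta>" "\<beta> \<le> 1 / 2"
  shows "rde_solution \<beta> A f g X XX 0 T y \<longleftrightarrow> integral_curve (rde_field A f g w) T (y 0) y"
    (is "?rde \<longleftrightarrow> ?curve")
proof -
  have w: "continuous_on {0..T} w"
    and X: "\<And>u v. 0 \<le> u \<Longrightarrow> u \<le> v \<Longrightarrow> v \<le> T \<Longrightarrow> incr X u v = integral {u..v} w"
    using lift unfolding smooth_lift_def by (blast, metis integral_unique)
  let ?F = "\<lambda>r. rde_field A f g w r (y r)"
  have split: "integral {s..t} ?F = integral {s..t} (\<lambda>r. A *v y r + f (y r))
      + integral {s..t} (\<lambda>r. g (y r) *v w r)"
    if y: "continuous_on {0..T} y" and st: "0 \<le> s" "t \<le> T" for s t
  proof -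
    have sub: "{s..t} \<subseteq> {0..T}" using st by auto
    note ys = continuous_on_subset[OF y sub] and ws = continuous_on_subset[OF w sub]
    show ?thesis
      unfolding rde_field_def
      by (intro integral_add integrable_continuous_real continuous_intros ws ys
          continuous_on_compose2[OF f ys] continuous_on_compose2[OF continuous_on_Cb3[OF g, of UNIV] ys])
        auto
  qed
  show ?thesis
  proof
    assume sol: ?rde
    then have y: "continuous_on {0..T} y"
      using \<beta> unfolding rde_solution_def by (blast intro: holder_incr_continuous)
    have "y t = y 0 + integral {0..t} ?F" if t: "t \<in> {0..T}" for t
    proof -
      have "has_rough_integral g X XX y 0 t (incr y 0 t - integral {0..t} (\<lambda>r. A *v y r + f (y r)))"
        using sol t unfolding rde_solution_def by auto
      moreover have "has_rough_integral g X XX y 0 t (integral {0..t} (\<lambda>r. g (y r) *v w r))"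
        by (rule has_rough_integral_smooth[OF lift g y]) (use t in auto)
      ultimately have "incr y 0 t - integral {0..t} (\<lambda>r. A *v y r + f (y r))
          = integral {0..t} (\<lambda>r. g (y r) *v w r)"
        by (rule has_rough_integral_unique)
      then show ?thesis
        using split[OF y, of 0 t] t by (simp add: incr_def algebra_simps)
    qed
    with y show ?curve unfolding integral_curve_def by blast
  next
    assume curve: ?curve
    note y = integral_curveD(1)[OF curve]
    have F: "continuous_on {0..T} ?F"
      by (rule continuous_on_rde_field[OF f g w y])
    have inc: "incr y s t = integral {s..t} ?F" if st: "0 \<le> s" "s \<le> t" "t \<le> T" for s t
    proof -
      have "integral {0..s} ?F + integral {s..t} ?F = integral {0..t} ?F"
        by (rule Henstock_Kurzweil_Integration.integral_combine)
           (use st in \<open>auto intro!: integrable_continuous_real continuous_on_subset[OF F]\<close>)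
      then show ?thesis
        using integral_curveD(2)[OF curve, of s] integral_curveD(2)[OF curve, of t] st
        by (simp add: incr_def algebra_simps)
    qed
    obtain M where M: "M \<ge> 0" "\<And>s t. s \<in> {0..T} \<Longrightarrow> t \<in> {0..T} \<Longrightarrow> norm (incr y s t) \<le> M * \<bar>t - s\<bar>"
      using incr_lipschitz_if_integral[OF F inc] by metis
    obtain N where N: "N \<ge> 0" "\<And>s t. s \<in> {0..T} \<Longrightarrow> t \<in> {0..T} \<Longrightarrow> norm (incr X s t) \<le> N * \<bar>t - s\<bar>"
      using incr_lipschitz_if_integral[OF w X] by metis
    obtain G where G: "G \<ge> 0" "\<And>x. norm (g x) \<le> G"
      using Cb3_bounds[OF g] by metis
    have "holder \<beta> {0..T} (incr y)"
      by (rule holder_if_lipschitz[OF M(2) M(1)]) (use \<beta> in auto)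
    moreover have "holder (2 * \<beta>) {0..T} (remainder g X y)"
    proof (rule holder_if_lipschitz)
      fix s t assume st: "s \<in> {0..T}" "t \<in> {0..T}"
      have "norm (g (y s) *v incr X s t) \<le> G * (N * \<bar>t - s\<bar>)"
        by (rule order_trans[OF norm_matrix_vector_le]) (intro mult_mono G N(2) st norm_ge_zero)
      with M(2)[OF st] show "norm (remainder g X y s t) \<le> (M + G * N) * \<bar>t - s\<bar>"
        unfolding remainder_def
        using norm_triangle_ineq4[of "incr y s t" "g (y s) *v incr X s t"]
        by (simp add: algebra_simps)
    qed (use M N G \<beta> in auto)
    moreover have "has_rough_integral g X XX y s t
        (incr y s t - integral {s..t} (\<lambda>r. A *v y r + f (y r)))"
      if "0 \<le> s \<and> s \<le> t \<and> t \<le> T" for s t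
      using has_rough_integral_smooth[OF lift g y, of s t] split[OF y, of s t] inc[of s t] that
      by simp
    ultimately show ?rde unfolding rde_solution_def by blast
  qed
qed

section \<open>The smoothed driver\<close>

definition velocity :: "real \<Rightarrow> (real \<Rightarrow> real ^ 'd) \<Rightarrow> real \<Rightarrow> real ^ 'd" where
  "velocity \<delta> \<omega> t = (1 / \<delta>) *\<^sub>R (\<omega> (t + \<delta>) - \<omega> t)"

text \<open>Written in terms of the shift, the velocity inherits joint measurability in time and path
  from the metric dynamical system.\<close>

lemma velocity_eq_shift: "velocity \<delta> \<omega> t = (1 / \<delta>) *\<^sub>R wiener_shift t \<omega> \<delta>"
  by (simp add: velocity_def wiener_shift_def add.commute)

lemma velocity_shift: "velocity \<delta> (wiener_shift s \<omega>) t = velocity \<delta> \<omega> (t + s)"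
  by (simp add: velocity_def wiener_shift_def add_ac)

lemma continuous_on_velocity:
  "continuous_on UNIV \<omega> \<Longrightarrow> continuous_on S (velocity \<delta> \<omega>)"
  unfolding velocity_def
  by (intro continuous_on_scaleR continuous_on_diff continuous_on_const
      continuous_on_compose2[of UNIV \<omega> S] continuous_on_add continuous_on_id) auto

lemma W\<delta>_has_derivative:
  assumes "continuous_on UNIV \<omega>"
  shows "(W\<delta> \<delta> \<omega> has_vector_derivative velocity \<delta> \<omega> t) (at t)"
proof -
  define b where "b = \<bar>t\<bar> + 1"
  have "((\<lambda>u. LBINT r=ereal 0..ereal u. velocity \<delta> \<omega> r) has_vector_derivative velocity \<delta> \<omega> t)
      (at t within {-b..b})"
    by (rule interval_integral_FTC2) (auto simp: b_def intro: continuous_on_velocity assms)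
  moreover have "at t within {-b..b} = at t"
    by (rule at_within_interior) (auto simp: b_def)
  moreover have "W\<delta> \<delta> \<omega> = (\<lambda>u. LBINT r=ereal 0..ereal u. velocity \<delta> \<omega> r)"
    by (simp add: fun_eq_iff W\<delta>_def velocity_def)
  ultimately show ?thesis by simp
qed

lemma smooth_lift_W\<delta>:
  assumes \<omega>: "continuous_on UNIV \<omega>"
  shows "smooth_lift T (velocity \<delta> \<omega>) (W\<delta> \<delta> \<omega>) (WW\<delta> \<delta> \<omega>)"
proof -
  let ?v = "velocity \<delta> \<omega>"
  note v = continuous_on_velocity[OF \<omega>]
  have W: "(?v has_integral incr (W\<delta> \<delta> \<omega>) s t) {s..t}" if "s \<le> t" for s t
    unfolding incr_def
    by (rule fundamental_theorem_of_calculus[OF that])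
       (rule has_vector_derivative_at_within[OF W\<delta>_has_derivative[OF \<omega>]])
  have cW: "continuous_on S (W\<delta> \<delta> \<omega>)" for S
    by (rule continuous_on_vector_derivative)
       (rule has_vector_derivative_at_within[OF W\<delta>_has_derivative[OF \<omega>]])
  have "bounded (?v ` {0..T})"
    by (intro compact_imp_bounded compact_continuous_image v) auto
  then obtain B where B: "B > 0" "\<And>r. r \<in> {0..T} \<Longrightarrow> norm (?v r) \<le> B"
    unfolding bounded_pos by auto
  have "norm (WW\<delta> \<delta> \<omega> s t) \<le> (B * B) * (t - s)\<^sup>2" if st: "0 \<le> s" "s \<le> t" "t \<le> T" for s t
  proof -
    let ?h = "\<lambda>r. tensor (incr (W\<delta> \<delta> \<omega>) s r) (?v r)"
    have h: "continuous_on {s..t} ?h"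
      by (rule bounded_bilinear.continuous_on[OF bounded_bilinear_tensor])
         (auto simp: incr_def intro!: continuous_intros cW v)
    have "WW\<delta> \<delta> \<omega> s t = (LBINT r=ereal s..ereal t. ?h r)"
      by (simp add: WW\<delta>_def vector_derivative_at[OF W\<delta>_has_derivative[OF \<omega>]])
    also have "\<dots> = integral {s..t} ?h"
      by (rule interval_integral_eq_integral[OF st(2) borel_integrable_atLeastAtMost'[OF h]])
    finally have eq: "WW\<delta> \<delta> \<omega> s t = integral {s..t} ?h" .
    have "norm (integral {s..t} ?h) \<le> (B * (t - s) * B) * (t - s)"
    proof (rule integral_bound[OF st(2) h])
      fix r assume r: "r \<in> {s..t}"
      have "norm (integral {s..r} ?v) \<le> B * (r - s)"
        by (rule integral_bound) (use r st B in \<open>auto intro: v\<close>)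
      also have "\<dots> \<le> B * (t - s)" using r B by simp
      finally have "norm (incr (W\<delta> \<delta> \<omega>) s r) \<le> B * (t - s)"
        using W[of s r] r by (simp add: integral_unique)
      then show "norm (?h r) \<le> B * (t - s) * B"
        unfolding norm_tensor by (intro mult_mono) (use r st B in auto)
    qed
    then show ?thesis unfolding eq by (simp add: power2_eq_square mult_ac)
  qed
  moreover have "B * B \<ge> 0" using B by simp
  ultimately show ?thesis
    unfolding smooth_lift_def using W v by blast
qed

section \<open>The approximating flow\<close>

definition approx_flow ::
  "real ^ 'm ^ 'm \<Rightarrow> (real ^ 'm \<Rightarrow> real ^ 'm) \<Rightarrow> (real ^ 'm \<Rightarrow> real ^ 'd ^ 'm) \<Rightarrow> real \<Rightarrow>
     real \<Rightarrow> (real \<Rightarrow> real ^ 'd) \<Rightarrow> real ^ 'm \<Rightarrow> real ^ 'm" where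
  "approx_flow A f g \<delta> t \<omega> x = ode_flow (rde_field A f g (velocity \<delta> \<omega>)) x t"

lemma approx_flow_generated:
  fixes g :: "real ^ 'm \<Rightarrow> real ^ 'd ^ 'm"
  assumes f: "C-lipschitz_on UNIV f" and g: "Cb3 g" and \<beta>: "0 < \<beta>" "\<beta> \<le> 1 / 2"
    and \<Omega>: "\<And>\<omega>. \<omega> \<in> \<Omega> \<Longrightarrow> continuous_on UNIV \<omega>"
  shows "generated_by_rde \<beta> A f g \<Omega> (W\<delta> \<delta>) (WW\<delta> \<delta>) (approx_flow A f g \<delta>)"
  unfolding generated_by_rde_def
proof (intro ballI allI impI conjI)
  fix \<omega> \<xi> assume \<omega>: "\<omega> \<in> \<Omega>"
  let ?F = "rde_field A f g (velocity \<delta> \<omega>)"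
  have F: "lipschitz_field ?F"
    by (rule lipschitz_field_rde_field[OF f g continuous_on_velocity[OF \<Omega>[OF \<omega>]]])
  note iff = rde_solution_smooth_iff[OF smooth_lift_W\<delta>[OF \<Omega>[OF \<omega>]]
      lipschitz_on_continuous_on[OF f] g \<beta>]
  show start: "approx_flow A f g \<delta> 0 \<omega> \<xi> = \<xi>"
    by (simp add: approx_flow_def ode_flow_0[OF F])
  fix T :: real assume "T > 0"
  have curve: "integral_curve ?F T \<xi> (\<lambda>t. approx_flow A f g \<delta> t \<omega> \<xi>)"
    unfolding approx_flow_def by (rule integral_curve_ode_flow[OF F])
  then show "rde_solution \<beta> A f g (W\<delta> \<delta> \<omega>) (WW\<delta> \<delta> \<omega>) 0 T (\<lambda>t. approx_flow A f g \<delta> t \<omega> \<xi>)"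
    by (simp add: iff start)
  fix y t
  assume "rde_solution \<beta> A f g (W\<delta> \<delta> \<omega>) (WW\<delta> \<delta> \<omega>) 0 T y \<and> y 0 = \<xi>" and t: "t \<in> {0..T}"
  then have "integral_curve ?F T \<xi> y" by (auto simp: iff)
  then show "y t = approx_flow A f g \<delta> t \<omega> \<xi>"
    using curve t by (rule integral_curve_unique[OF F])
qed

lemma approx_flow_rds:
  fixes g :: "real ^ 'm \<Rightarrow> real ^ 'd ^ 'm"
  assumes f: "C-lipschitz_on UNIV f" and g: "Cb3 g"
    and cont: "\<And>\<omega>. \<omega> \<in> space M \<Longrightarrow> continuous_on UNIV \<omega>"
    and eval: "(\<lambda>\<omega>. \<omega> \<delta>) \<in> borel_measurable M"
    and mds: "metric_dynamical_system M wiener_shift"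
  shows "random_dynamical_system M wiener_shift (approx_flow A f g \<delta>)"
proof -
  let ?F = "\<lambda>\<omega>. rde_field A f g (velocity \<delta> \<omega>)"
  have F: "lipschitz_field (?F \<omega>)" if "continuous_on UNIV \<omega>" for \<omega> :: "real \<Rightarrow> real ^ 'd"
    by (rule lipschitz_field_rde_field[OF f g continuous_on_velocity[OF that]])
  have shift: "(\<lambda>(t, \<omega>). wiener_shift t \<omega>) \<in> borel \<Otimes>\<^sub>M M \<rightarrow>\<^sub>M M"
    using mds unfolding metric_dynamical_system_def by blast
  let ?N = "M \<Otimes>\<^sub>M (borel \<Otimes>\<^sub>M borel) :: ((real \<Rightarrow> (real ^ 'd)) \<times> real \<times> (real ^ 'm)) measure"
  have "(\<lambda>z. wiener_shift (fst (snd z)) (fst z)) \<in> ?N \<rightarrow>\<^sub>M M"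
    using measurable_compose[OF _ shift, of "\<lambda>z. (fst (snd z), fst z)" ?N] by simp
  then have "(\<lambda>z. wiener_shift (fst (snd z)) (fst z) \<delta>) \<in> borel_measurable ?N"
    by (rule measurable_compose[OF _ eval])
  then have v: "(\<lambda>z. velocity \<delta> (fst z) (fst (snd z))) \<in> borel_measurable ?N"
    unfolding velocity_eq_shift by (intro borel_measurable_scaleR) auto
  have x: "(\<lambda>z. h (snd (snd z))) \<in> borel_measurable ?N" if "continuous_on UNIV h"
    for h :: "real ^ 'm \<Rightarrow> 'c::topological_space"
    by (rule measurable_compose[OF _ borel_measurable_continuous_onI[OF that]]) simp
  have "(\<lambda>z. g (snd (snd z)) *v velocity \<delta> (fst z) (fst (snd z))) \<in> borel_measurable ?N"
    by (rule borel_measurable_continuous_Pair[OF x[OF continuous_on_Cb3[OF g]] v])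
       (intro continuous_intros)
  then have "(\<lambda>(\<omega>, r, y). ?F \<omega> r y) \<in> borel_measurable ?N"
    unfolding rde_field_def case_prod_beta
    by (intro borel_measurable_add x lipschitz_on_continuous_on[OF f] continuous_intros)
  from measurable_ode_flow[OF this]
  have flow: "(\<lambda>(t, \<omega>, x). approx_flow A f g \<delta> t \<omega> x) \<in> borel_measurable (borel \<Otimes>\<^sub>M (M \<Otimes>\<^sub>M borel))"
    by (simp add: approx_flow_def)
  have incl: "(\<lambda>t::real. t) \<in> restrict_space borel {0..} \<rightarrow>\<^sub>M borel"
    by (rule measurable_restrict_space1) simp
  have id: "(\<lambda>p. (fst p, snd p))
      \<in> restrict_space borel {0..} \<Otimes>\<^sub>M (M \<Otimes>\<^sub>M borel)
        \<rightarrow>\<^sub>M (borel :: real measure) \<Otimes>\<^sub>M (M \<Otimes>\<^sub>M (borel :: (real ^ 'm) measure))"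
    by (rule measurable_Pair, rule measurable_compose[OF measurable_fst incl], rule measurable_snd)
  show ?thesis
    unfolding random_dynamical_system_def
  proof (intro conjI ballI allI impI)
    show "(\<lambda>(t, \<omega>, x). approx_flow A f g \<delta> t \<omega> x)
        \<in> restrict_space borel {0..} \<Otimes>\<^sub>M (M \<Otimes>\<^sub>M borel) \<rightarrow>\<^sub>M borel"
      using measurable_compose[OF id flow] by simp
    fix \<omega> and x :: "real ^ 'm" assume \<omega>: "\<omega> \<in> space M"
    show "approx_flow A f g \<delta> 0 \<omega> x = x"
      by (simp add: approx_flow_def ode_flow_0[OF F[OF cont[OF \<omega>]]])
    fix s t :: real assume st: "s \<ge> 0" "t \<ge> 0"
    have "wiener_shift s \<omega> \<in> space M"
      using measurable_space[OF shift, of "(s, \<omega>)"] \<omega> by (simp add: space_pair_measure)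
    from ode_flow_shift[OF F[OF cont[OF \<omega>]] F[OF cont[OF this]] _ st]
    show "approx_flow A f g \<delta> (s + t) \<omega> x
        = approx_flow A f g \<delta> t (wiener_shift s \<omega>) (approx_flow A f g \<delta> s \<omega> x)"
      by (simp add: approx_flow_def rde_field_def velocity_shift)
  qed
qed

text \<open>Gaussianity of the one-time marginals contains their measurability.\<close>

lemma fbm_law_measurable_eval:
  fixes L :: "(real \<Rightarrow> real ^ 'd) measure"
  assumes "fbm_law H L"
  shows "(\<lambda>\<omega>. \<omega> t) \<in> borel_measurable L"
proof -
  have "(\<lambda>\<omega>. \<omega> t $ i) \<in> borel_measurable L" for i
  proof -
    have "centered_gaussian_process L (\<lambda>t \<omega>. \<omega> t $ i)"
      using assms unfolding fbm_law_def fractional_brownian_motion_def by blast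
    then have "centered_gaussian L (\<lambda>\<omega>. \<Sum>s\<in>{t}. 1 * \<omega> s $ i)"
      unfolding centered_gaussian_process_def by (elim allE[of _ "{t}"] allE[of _ "\<lambda>_. 1"]) simp
    then show ?thesis by (simp add: centered_gaussian_def)
  qed
  then show ?thesis
    by (subst borel_measurable_euclidean_space) (auto simp: Basis_vec_def inner_axis)
qed

text \<open>In the convergence hypothesis the two variation terms are nonnegative, so the supremum
  norm alone is squeezed to zero.\<close>

lemma wong_zakai_flow_convergence:
  fixes g :: "real ^ 'm \<Rightarrow> real ^ 'd ^ 'm"
  assumes wz: "wong_zakai_approximation \<beta> A f g \<Omega> \<omega>2" and "\<beta> > 0"
    and gen: "generated_by_rde \<beta> A f g \<Omega> (\<lambda>\<omega>. \<omega>) \<omega>2 \<phi>"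
    and gen\<delta>: "\<And>\<delta>. \<delta> \<in> {0<..<1} \<Longrightarrow> generated_by_rde \<beta> A f g \<Omega> (W\<delta> \<delta>) (WW\<delta> \<delta>) (\<phi>\<delta> \<delta>)"
    and \<omega>: "\<omega> \<in> \<Omega>" and T: "T > 0" and \<xi>: "(\<xi>\<delta> \<longlongrightarrow> \<xi>) (at_right 0)"
  shows "((\<lambda>\<delta>. SUP t\<in>{0..T}. norm (\<phi>\<delta> \<delta> t \<omega> (\<xi>\<delta> \<delta>) - \<phi> t \<omega> \<xi>)) \<longlongrightarrow> 0) (at_right 0)"
proof -
  let ?y = "\<lambda>t. \<phi> t \<omega> \<xi>" and ?z = "\<lambda>\<delta> t. \<phi>\<delta> \<delta> t \<omega> (\<xi>\<delta> \<delta>)"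
  have y: "rde_solution \<beta> A f g \<omega> (\<omega>2 \<omega>) 0 T ?y" "?y 0 = \<xi>"
    using gen \<omega> T unfolding generated_by_rde_def by blast+
  have z: "rde_solution \<beta> A f g (W\<delta> \<delta> \<omega>) (WW\<delta> \<delta> \<omega>) 0 T (?z \<delta>)" "?z \<delta> 0 = \<xi>\<delta> \<delta>"
    if "\<delta> \<in> {0<..<1}" for \<delta>
    using gen\<delta>[OF that] \<omega> T unfolding generated_by_rde_def by blast+
  have small: "\<forall>\<^sub>F \<delta> in at_right 0. \<delta> \<in> {0<..<1::real}"
    by (rule eventually_at_right_real) simp
  have "((\<lambda>\<delta>. norm (\<xi>\<delta> \<delta> - \<xi>)) \<longlongrightarrow> 0) (at_right 0)"
    using \<xi> by (simp add: LIM_zero tendsto_norm_zero)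
  then have "((\<lambda>\<delta>. norm (?z \<delta> 0 - ?y 0)) \<longlongrightarrow> 0) (at_right 0)"
    by (rule Lim_transform_eventually) (use small in eventually_elim, simp add: z(2) y(2))
  then have lim:
    "((\<lambda>\<delta>. (SUP t\<in>{0..0 + T}. norm (?y t - ?z \<delta> t)) +
        pvar (1 / \<beta>) 0 (0 + T) (incr (\<lambda>t. ?y t - ?z \<delta> t)) +
        pvar (1 / \<beta> / 2) 0 (0 + T)
          (\<lambda>s t. remainder g (W\<delta> \<delta> \<omega>) (?z \<delta>) s t - remainder g \<omega> ?y s t))
      \<longlongrightarrow> 0) (at_right 0)"
    using wz[unfolded wong_zakai_approximation_def, THEN bspec, OF \<omega>, THEN spec, THEN spec,
        THEN spec, THEN spec, THEN mp, of T 0 ?y ?z] T y(1) z(1) unfolding add_0 by blast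
  \<comment> \<open>A real supremum is only known to be nonnegative if the set is bounded above.\<close>
  have nonneg: "0 \<le> (SUP t\<in>{0..T}. norm (?z \<delta> t - ?y t))" if "\<delta> \<in> {0<..<1}" for \<delta>
  proof -
    have "continuous_on {0..T} ?y" "continuous_on {0..T} (?z \<delta>)"
      using y(1) z(1)[OF that] \<open>\<beta> > 0\<close> unfolding rde_solution_def
      by (blast intro: holder_incr_continuous)+
    then have "bounded ((\<lambda>t. norm (?z \<delta> t - ?y t)) ` {0..T})"
      by (intro compact_imp_bounded compact_continuous_image continuous_intros) auto
    then have "bdd_above ((\<lambda>t. norm (?z \<delta> t - ?y t)) ` {0..T})"
      by (rule bounded_imp_bdd_above)
    then have "norm (?z \<delta> 0 - ?y 0) \<le> (SUP t\<in>{0..T}. norm (?z \<delta> t - ?y t))"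
      by (rule cSUP_upper[rotated]) (use T in simp)
    then show ?thesis
      by (rule order_trans[OF norm_ge_zero])
  qed
  show ?thesis
  proof (rule tendsto_sandwich[OF _ _ tendsto_const lim])
    show "\<forall>\<^sub>F \<delta> in at_right 0. 0 \<le> (SUP t\<in>{0..T}. norm (?z \<delta> t - ?y t))"
      using small by eventually_elim (rule nonneg)
    show "\<forall>\<^sub>F \<delta> in at_right 0. (SUP t\<in>{0..T}. norm (?z \<delta> t - ?y t)) \<le>
        (SUP t\<in>{0..0 + T}. norm (?y t - ?z \<delta> t)) +
        pvar (1 / \<beta>) 0 (0 + T) (incr (\<lambda>t. ?y t - ?z \<delta> t)) +
        pvar (1 / \<beta> / 2) 0 (0 + T)
          (\<lambda>s t. remainder g (W\<delta> \<delta> \<omega>) (?z \<delta>) s t - remainder g \<omega> ?y s t)"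
      by (intro always_eventually) (simp add: pvar_def norm_minus_commute)
  qed
qed

theorem mainTheorem5:
  fixes H \<beta> :: real
    and A :: "real ^ 'm ^ 'm"
    and f :: "real ^ 'm \<Rightarrow> real ^ 'm"
    and g :: "real ^ 'm \<Rightarrow> real ^ 'd ^ 'm"
    and L P P' :: "(real \<Rightarrow> real ^ 'd) measure"
    and \<Omega> \<Omega>' :: "(real \<Rightarrow> real ^ 'd) set"
    and \<omega>2 :: "(real \<Rightarrow> real ^ 'd) \<Rightarrow> real \<Rightarrow> real \<Rightarrow> real ^ 'd ^ 'd"
    and \<phi> :: "real \<Rightarrow> (real \<Rightarrow> real ^ 'd) \<Rightarrow> real ^ 'm \<Rightarrow> real ^ 'm"
  assumes "1 / 3 < \<beta>" and "\<beta> < H" and "H < 1 / 2"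
    and "\<exists>C. C-lipschitz_on UNIV f"
    and "Cb3 g"
    and "fbm_law H L"
    and "\<Omega> \<in> sets L" and "measure L \<Omega> = 1"
    and "\<And>t \<omega>. \<omega> \<in> \<Omega> \<Longrightarrow> wiener_shift t \<omega> \<in> \<Omega>"
    and "\<And>\<omega> T. \<omega> \<in> \<Omega> \<Longrightarrow> T > 0 \<Longrightarrow> holder \<beta> {-T..T} (incr \<omega>)"
    and "P = restrict_space L \<Omega>"
    and "\<Omega>' \<in> sets P" and "measure P \<Omega>' = 1"
    and "\<And>t \<omega>. \<omega> \<in> \<Omega>' \<Longrightarrow> wiener_shift t \<omega> \<in> \<Omega>'"
    and "\<And>\<omega> T. \<omega> \<in> \<Omega>' \<Longrightarrow> T > 0 \<Longrightarrow> rough_path \<beta> {-T..T} \<omega> (\<omega>2 \<omega>)"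
    and "\<And>\<omega> T. \<omega> \<in> \<Omega>' \<Longrightarrow> T > 0 \<Longrightarrow>
           ((\<lambda>\<delta>. rough_dist \<beta> {-T..T} (W\<delta> \<delta> \<omega>) (WW\<delta> \<delta> \<omega>) \<omega> (\<omega>2 \<omega>)) \<longlongrightarrow> 0) (at_right 0)"
    and "P' = restrict_space P \<Omega>'"
    and "ergodic_metric_dynamical_system P' wiener_shift"
    and "generated_by_rde \<beta> A f g \<Omega>' (\<lambda>\<omega>. \<omega>) \<omega>2 \<phi>"
    and "random_dynamical_system P' wiener_shift \<phi>"
  shows "\<exists>\<phi>\<delta>.
    (\<forall>\<delta>\<in>{0<..<1}. generated_by_rde \<beta> A f g \<Omega>' (W\<delta> \<delta>) (WW\<delta> \<delta>) (\<phi>\<delta> \<delta>) \<and>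
                    random_dynamical_system P' wiener_shift (\<phi>\<delta> \<delta>)) \<and>
    (wong_zakai_approximation \<beta> A f g \<Omega>' \<omega>2 \<longrightarrow>
      (\<forall>\<omega>\<in>\<Omega>'. \<forall>T>0. \<forall>\<xi> \<xi>\<delta>. (\<xi>\<delta> \<longlongrightarrow> \<xi>) (at_right 0) \<longrightarrow>
        ((\<lambda>\<delta>. SUP t\<in>{0..T}. norm (\<phi>\<delta> \<delta> t \<omega> (\<xi>\<delta> \<delta>) - \<phi> t \<omega> \<xi>)) \<longlongrightarrow> 0) (at_right 0)))"
proof -
  obtain C where f: "C-lipschitz_on UNIV f" using assms(4) by blast
  have \<beta>: "0 < \<beta>" "\<beta> \<le> 1 / 2" using assms(1-3) by auto
  have L: "space L = C0" using assms(6) by (simp add: fbm_law_def)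
  have sub: "\<Omega>' \<subseteq> \<Omega>" "\<Omega> \<subseteq> C0"
    using sets.sets_into_space[OF assms(12)] sets.sets_into_space[OF assms(7)] L
    by (auto simp: assms(11) space_restrict_space)
  then have space: "space P' = \<Omega>'"
    by (auto simp: assms(11,17) space_restrict_space L)
  have cont: "continuous_on UNIV \<omega>" if "\<omega> \<in> \<Omega>'" for \<omega>
    using that sub by (auto simp: C0_def)
  have eval: "(\<lambda>\<omega>. \<omega> \<delta>) \<in> borel_measurable P'" for \<delta>
    unfolding assms(11,17) by (intro measurable_restrict_space1 fbm_law_measurable_eval[OF assms(6)])
  have mds: "metric_dynamical_system P' wiener_shift"
    using assms(18) by (simp add: ergodic_metric_dynamical_system_def)
  have gen: "generated_by_rde \<beta> A f g \<Omega>' (W\<delta> \<delta>) (WW\<delta> \<delta>) (approx_flow A f g \<delta>)" for \<delta>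
    by (rule approx_flow_generated[OF f assms(5) \<beta> cont])
  have rds: "random_dynamical_system P' wiener_shift (approx_flow A f g \<delta>)" for \<delta>
    by (rule approx_flow_rds[OF f assms(5) _ eval mds]) (simp add: space cont)
  show ?thesis
    using gen rds wong_zakai_flow_convergence[OF _ \<beta>(1) assms(19) gen]
    by (intro exI[of _ "approx_flow A f g"]) blast
qed

end
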